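(* Let $s\in(\frac18,1)$ and set $p=\frac1s\in(1,8)$. Let $\eta:\mathbb S^1\to\mathbb R$ be a trigonometric polynomial, $\eta(e^{\mathrm i\theta})=\sum_{n\in\mathbb Z}c_ne^{\mathrm in\theta}$ with $c_n\in\mathbb C$. Then $$\mathcal Q_p(\eta)=4\pi\sum_{n\in\mathbb Z}M_{|n|}(p)\,|c_n|^2,$$ with $M_0(p)=M_1(p)=0$, and $M_n(p)\ge0$ for all $n\in\mathbb N$. Moreover, if $1<p<3$ (equivalently $s\in(\frac13,1)$), then there exist constants $0<a_p\le b_p<\infty$ (independent of $n$ and $\eta$) such that $$a_p\,n^{3-p}\le M_n(p)\le b_p\,n^{3-p}\qquad\text{for every }n\ge2,$$ and consequently $$a_p\sum_{|n|\ge2}|n|^{3-p}|c_n|^2\le\mathcal Q_p(\eta)\le b_p\sum_{|n|\ge2}|n|^{3-p}|c_n|^2 .$$ The constants $a_p,b_p$ can be chosen uniformly as long as $p$ keeps a positive distance from $1$ and $3$. Equivalently, $\mathcal Q_p(\eta)\asymp\|\eta\|^2_{\dot H^{\frac{3-p}2}(\mathbb S^1)}$ whenever $$\int_0^{2\pi}\eta(e^{\mathrm i\theta})\,d\theta=0,\qquad\int_0^{2\pi}\eta(e^{\mathrm i\theta})e^{\mathrm i\theta}\,d\theta=0 .$$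
   Context: $\mathbb S^1\subset\mathbb C\simeq\mathbb R^2$ is the unit circle with arclength measure $dx$, $|x-y|$ is the Euclidean distance, $\langle\cdot,\cdot\rangle$ the Euclidean inner product of $\mathbb R^2$, and $x^\perp=\mathrm ix$. For $p>1$ and $\eta:\mathbb S^1\to\mathbb R$, $$\mathcal Q_p(\eta)=\iint_{\mathbb S^1\times\mathbb S^1}\frac{\big[(p-2)|\langle x,y^\perp\rangle|^2|x-y|^{p-4}+|x-y|^{p-2}\langle x,y\rangle\big]\,|\eta(x)-\eta(y)|^2}{|x-y|^2}\,dx\,dy .$$ For $n\in\mathbb N\cup\{0\}$, $$M_n(p)=2^{p-3}\int_0^\pi\sin^{p-4}(r)\,\big(p\cos^2 r-1\big)\,\big(1-\cos(2nr)\big)\,dr .$$ The homogeneous Sobolev norm is $\|\eta\|^2_{\dot H^{t}(\mathbb S^1)}=\sum_{n\ne0}|n|^{2t}|c_n|^2$ (up to a fixed normalizing constant). *)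

theory Defs
  imports "HOL-Analysis.Analysis"
begin

text \<open>Arclength on the unit circle, as the image of Lebesgue measure under the unit-speed
  parametrization. The target space is the circle itself and not the whole plane, so that
  measurability of a function concerns only its values on the circle.\<close>

definition circle_measure :: "complex measure" where
  "circle_measure =
     distr (restrict_space lborel {0..<2 * pi}) (restrict_space borel (sphere 0 1)) cis"

lemma cis_measurable_circle:
  "cis \<in> restrict_space lborel {0..<2 * pi} \<rightarrow>\<^sub>M restrict_space borel (sphere 0 1)"
  by (rule measurable_restrict_space2)
    (auto intro!: measurable_restrict_space1 borel_measurable_continuous_onI continuous_on_cis)

lemma space_circle_measure: "space circle_measure = sphere 0 1"
  by (simp add: circle_measure_def space_restrict_space)

lemma emeasure_circle_measure: "emeasure circle_measure (sphere 0 1) = ennreal (2 * pi)"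
proof -
  have "cis -` sphere 0 1 \<inter> space (restrict_space lborel {0..<2 * pi}) = {0..<2 * pi}"
    by (auto simp: space_restrict_space)
  moreover have "sphere 0 1 \<in> sets (restrict_space borel (sphere (0::complex) 1))"
    by (metis borel_closed closed_sphere inf.idem sets_restrict_space_iff space_borel
        Int_UNIV_right sets.top space_restrict_space)
  ultimately show ?thesis
    unfolding circle_measure_def
    by (subst emeasure_distr[OF cis_measurable_circle])
      (simp_all add: emeasure_restrict_space)
qed

text \<open>The plane is identified with the complex numbers: \<^term>\<open>x \<bullet> y\<close> is the
  Euclidean inner product and the rotation of \<^term>\<open>y\<close> by a right angle is
  \<^term>\<open>\<i> * y\<close>. The conventions for \<^term>\<open>0 powr a\<close> and division by zero matter
  only on the diagonal, a null set.\<close>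

definition Qp_integrand :: "real \<Rightarrow> (complex \<Rightarrow> real) \<Rightarrow> complex \<Rightarrow> complex \<Rightarrow> real" where
  "Qp_integrand p \<eta> x y =
     ((p - 2) * \<bar>x \<bullet> (\<i> * y)\<bar>\<^sup>2 * norm (x - y) powr (p - 4)
        + norm (x - y) powr (p - 2) * (x \<bullet> y)) * \<bar>\<eta> x - \<eta> y\<bar>\<^sup>2 / (norm (x - y))\<^sup>2"

definition Qp :: "real \<Rightarrow> (complex \<Rightarrow> real) \<Rightarrow> real" where
  "Qp p \<eta> = (LINT z|(circle_measure \<Otimes>\<^sub>M circle_measure). Qp_integrand p \<eta> (fst z) (snd z))"

definition Mn_integrand :: "nat \<Rightarrow> real \<Rightarrow> real \<Rightarrow> real" where
  "Mn_integrand n p r =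
     sin r powr (p - 4) * (p * (cos r)\<^sup>2 - 1) * (1 - cos (2 * real n * r))"

definition Mn :: "nat \<Rightarrow> real \<Rightarrow> real" where
  "Mn n p = 2 powr (p - 3) * (LBINT r:{0..pi}. Mn_integrand n p r)"

text \<open>A real-valued trigonometric polynomial on the circle together with its coefficients;
  off the circle \<open>\<eta>\<close> is arbitrary.\<close>

definition trig_poly :: "(complex \<Rightarrow> real) \<Rightarrow> (int \<Rightarrow> complex) \<Rightarrow> bool" where
  "trig_poly \<eta> c \<longleftrightarrow> finite {n. c n \<noteq> 0} \<and>
     (\<forall>\<theta>::real. complex_of_real (\<eta> (exp (\<i> * of_real \<theta>))) =
        (\<Sum>n | c n \<noteq> 0. c n * exp (\<i> * of_int n * of_real \<theta>)))"

definition fourier_coeff :: "(complex \<Rightarrow> real) \<Rightarrow> int \<Rightarrow> complex" where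
  "fourier_coeff \<eta> n =
     (LBINT \<theta>:{0..2 * pi}. complex_of_real (\<eta> (exp (\<i> * of_real \<theta>)))
        * exp (- \<i> * of_int n * of_real \<theta>)) / of_real (2 * pi)"

text \<open>The squared homogeneous Sobolev norm of order \<open>t\<close>, with normalizing constant 1.\<close>

definition Hdot_norm_sq :: "real \<Rightarrow> (complex \<Rightarrow> real) \<Rightarrow> real" where
  "Hdot_norm_sq t \<eta> =
     (\<Sum>\<^sub>\<infinity>n\<in>{n::int. n \<noteq> 0}. real_of_int \<bar>n\<bar> powr (2 * t) * (norm (fourier_coeff \<eta> n))\<^sup>2)"

end

theory Submission
  imports Defs
begin

text \<open>In the angular variable the kernel of \<open>\<Q>\<^sub>p\<close> depends only on the difference of the two angles, so the
  form is diagonal in the Fourier basis. Its diagonal entries are the integrals \<open>M\<^sub>n(p)\<close> after the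
  substitution \<open>h = 2r\<close>. Although the kernel is not integrable for \<open>p \<le> 3\<close>, it becomes so after
  multiplication by \<open>(1 - e\<^sup>i\<^sup>m\<^sup>h)(1 - e\<^sup>-\<^sup>i\<^sup>n\<^sup>h)\<close>; since \<open>\<eta>\<close> has finitely many modes, the double integral
  reduces to a finite double sum of such coupling coefficients (\<open>double_integral\<close>, \<open>Qp_trig_poly\<close>).

  The analysis of the multipliers rests on an exact formula. Because
  \<open>sin\<^sup>p\<^sup>-\<^sup>2 r (p cos\<^sup>2 r - 1)\<close> is the derivative of \<open>sin\<^sup>p\<^sup>-\<^sup>1 r cos r\<close>, the second difference of \<open>M\<^sub>n\<close> in
  \<open>n\<close> is a multiple of \<open>n\<^sup>2 \<integral> sin\<^sup>p r cos 2nr dr\<close>, and these moments satisfy a first-order recurrence.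
  With \<open>a = p/2\<close> and the vanishing of \<open>M\<^sub>0\<close> and \<open>M\<^sub>1\<close> this gives
  \<open>M\<^sub>n = C(p) \<Sum>\<^bsub>1\<le>m<n\<^esub> m (m+1) V\<^sub>m\<close>, where \<open>V\<^sub>1 = 1/(a(a+1))\<close>, \<open>V\<^bsub>m+1\<^esub> = V\<^sub>m (m+1-a)/(m+1+a)\<close> and
  \<open>C(p) > 0\<close> (\<open>Mn_integral_eq_sum_increment\<close>).

  Nonnegativity for \<open>1 < p < 8\<close> follows from the signs of \<open>V\<^sub>m\<close> together with a closed form of the sum
  (\<open>sum_increment_nonneg\<close>). For \<open>1 < p < 3\<close> all \<open>V\<^sub>m\<close> are positive, and comparing the factors
  \<open>(x-a)/(x+a)\<close> with powers of \<open>(x-1)/x\<close> and \<open>x/(x+1)\<close> shows that \<open>V\<^sub>m\<close> lies between constant multiples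
  of \<open>m\<^sup>-\<^sup>2\<^sup>a\<close>. Summation gives \<open>M\<^sub>n\<close> of order \<open>n\<^sup>3\<^sup>-\<^sup>p\<close> with explicit constants (\<open>Mn_bounds\<close>), whose
  dependence on \<open>p\<close> is visible.\<close>



section \<open>Powers of the sine\<close>

text \<open>The antiderivatives used below are differentiable only inside the interval, because
  \<^term>\<open>sin r powr q\<close> with a fractional exponent loses its derivative at \<open>0\<close> and \<open>\<pi>\<close>.\<close>

lemma LBINT_FTC_interior:
  fixes f F :: "real \<Rightarrow> real"
  assumes "a \<le> b" and "continuous_on {a..b} F"
    and "\<And>x. \<lbrakk>a < x; x < b\<rbrakk> \<Longrightarrow> (F has_real_derivative f x) (at x)"
    and "set_integrable lborel {a..b} f"
  shows "(LBINT x:{a..b}. f x) = F b - F a"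
proof -
  have "(f has_integral F b - F a) {a..b}"
    using assms(1-3)
    by (intro fundamental_theorem_of_calculus_interior)
      (auto simp: has_real_derivative_iff_has_vector_derivative)
  then show ?thesis
    using set_borel_integral_eq_integral(2)[OF assms(4)] by (simp add: integral_unique)
qed

lemma set_integrable_mult_bounded:
  fixes f g :: "real \<Rightarrow> real"
  assumes "set_integrable lborel S f" and "S \<in> sets borel" and "g \<in> borel_measurable borel"
    and "\<And>x. x \<in> S \<Longrightarrow> \<bar>g x\<bar> \<le> B"
  shows "set_integrable lborel S (\<lambda>x. f x * g x)"
proof -
  have i: "integrable lborel (\<lambda>x. B * (indicator S x * f x))"
    using assms(1) unfolding set_integrable_def by simp
  have m: "(\<lambda>x. indicator S x * f x) \<in> borel_measurable lborel"
    using assms(1) unfolding set_integrable_def by (simp add: borel_measurable_integrable)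
  have eq: "(\<lambda>x. indicator S x *\<^sub>R (f x * g x)) = (\<lambda>x. (indicator S x * f x) * g x)"
    by auto
  show ?thesis
    unfolding set_integrable_def eq
  proof (rule Bochner_Integration.integrable_bound[OF i])
    show "(\<lambda>x. (indicator S x * f x) * g x) \<in> borel_measurable lborel"
      using m assms(3) by measurable
    show "AE x in lborel. norm ((indicator S x * f x) * g x) \<le> norm (B * (indicator S x * f x))"
    proof (intro AE_I2)
      fix x
      show "norm ((indicator S x * f x) * g x) \<le> norm (B * (indicator S x * f x))"
        using assms(4)[of x] mult_left_mono[of "\<bar>g x\<bar>" "\<bar>B\<bar>" "\<bar>f x\<bar>"]
        by (cases "x \<in> S") (auto simp: abs_mult mult.commute)
    qed
  qed
qed

lemma continuous_on_sin_powr: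
  "0 < q \<Longrightarrow> continuous_on {0..pi} (\<lambda>r. sin r powr q)"
  by (intro continuous_on_powr' continuous_intros) (auto simp: sin_ge_zero)

lemma DERIV_sin_powr:
  assumes "0 < sin r"
  shows "((\<lambda>r. sin r powr q) has_real_derivative q * sin r powr (q - 1) * cos r) (at r)"
  using assms by (auto intro!: derivative_eq_intros simp: powr_diff field_simps)

text \<open>The derivative of \<open>sin\<^sup>q\<^sup>+\<^sup>1 r cos r\<close> is
  \<open>(q+1) sin\<^sup>q r - (q+2) sin\<^sup>q\<^sup>+\<^sup>2 r\<close>. Both the antiderivative and the second summand are continuous on
  the closed interval, which exhibits the singular term \<open>sin\<^sup>q r\<close> as gauge integrable; being
  nonnegative it is then Lebesgue integrable.\<close>

lemma sin_powr_integrable: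
  assumes q: "-1 < (q::real)"
  shows "set_integrable lborel {0..pi} (\<lambda>r. sin r powr q)"
proof -
  have c: "(\<lambda>r. sin r powr (q + 2)) integrable_on {0..pi}"
    using q by (intro integrable_continuous_real continuous_on_sin_powr) auto
  have "((\<lambda>r. (q + 1) * sin r powr q - (q + 2) * sin r powr (q + 2)) has_integral
      sin pi powr (q + 1) * cos pi - sin 0 powr (q + 1) * cos 0) {0..pi}"
  proof (rule fundamental_theorem_of_calculus_interior)
    show "continuous_on {0..pi} (\<lambda>r. sin r powr (q + 1) * cos r)"
      using q by (intro continuous_on_mult continuous_on_sin_powr continuous_intros) auto
    fix r :: real assume "r \<in> {0<..<pi}"
    then have s: "0 < sin r" by (auto intro: sin_gt_zero)
    have pw: "sin r powr (q + 1) = sin r powr q * sin r" "sin r powr (q + 2) = sin r powr q * (sin r)\<^sup>2"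
      using s by (simp_all add: powr_add)
    have "((\<lambda>r. sin r powr (q + 1) * cos r) has_real_derivative
        (q + 1) * sin r powr (q + 1 - 1) * cos r * cos r + - sin r * sin r powr (q + 1)) (at r)"
      by (rule DERIV_mult[OF DERIV_sin_powr[OF s] DERIV_cos])
    also have "(q + 1) * sin r powr (q + 1 - 1) * cos r * cos r + - sin r * sin r powr (q + 1) =
        (q + 1) * sin r powr q - (q + 2) * sin r powr (q + 2)"
      using sin_cos_squared_add[of r] unfolding pw by (simp only: add_diff_cancel) algebra
    finally show "((\<lambda>r. sin r powr (q + 1) * cos r) has_vector_derivative
       (q + 1) * sin r powr q - (q + 2) * sin r powr (q + 2)) (at r)"
      by (simp add: has_real_derivative_iff_has_vector_derivative)
  qed auto
  then have "(\<lambda>r. (q + 1) * sin r powr q - (q + 2) * sin r powr (q + 2)) integrable_on {0..pi}"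
    by blast
  from integrable_add[OF this integrable_on_mult_right[OF c, of "q + 2"]]
  have "(\<lambda>r. (q + 1) * sin r powr q) integrable_on {0..pi}" by simp
  then have "(\<lambda>r. sin r powr q) integrable_on {0..pi}"
    using q by (simp add: integrable_on_cmult_left_iff)
  then have "(\<lambda>r. sin r powr q) absolutely_integrable_on {0..pi}"
    by (intro nonnegative_absolutely_integrable_1) auto
  then have "integrable lebesgue (\<lambda>r. indicator {0..pi} r *\<^sub>R sin r powr q)"
    unfolding set_integrable_def .
  then show ?thesis
    unfolding set_integrable_def by (subst (asm) integrable_completion) auto
qed

lemma abs_sin_nat_mult_le: "\<bar>sin (real n * r)\<bar> \<le> real n * \<bar>sin r\<bar>"
proof (induction n)
  case (Suc n)
  have "real (Suc n) * r = real n * r + r" by (simp add: distrib_right)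
  then have "\<bar>sin (real (Suc n) * r)\<bar> \<le> \<bar>sin (real n * r) * cos r\<bar> + \<bar>cos (real n * r) * sin r\<bar>"
    by (simp only: sin_add abs_triangle_ineq)
  also have "\<dots> \<le> \<bar>sin (real n * r)\<bar> * 1 + 1 * \<bar>sin r\<bar>"
    unfolding abs_mult by (intro add_mono mult_mono) auto
  finally show ?case using Suc by (simp add: distrib_right)
qed simp

lemma one_minus_cos_double: "1 - cos (2 * x) = 2 * (sin x)\<^sup>2" for x :: real
  by (simp add: cos_double_sin)

section \<open>The multipliers satisfy a second-order difference equation\<close>

text \<open>The factor \<open>1 - cos 2nr = 2 sin\<^sup>2 nr\<close> is at most \<open>2n\<^sup>2 sin\<^sup>2 r\<close>, so it raises the exponent of the
  sine from \<open>p - 4\<close> to the integrable \<open>p - 2\<close>.\<close>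

lemma Mn_integrand_integrable:
  assumes p: "1 < p"
  shows "set_integrable lborel {0..pi} (Mn_integrand n p)"
proof -
  define g where "g = (\<lambda>r. (p * (cos r)\<^sup>2 - 1) * ((1 - cos (2 * real n * r)) / (sin r)\<^sup>2))"
  have "\<bar>g r\<bar> \<le> (p + 1) * (2 * (real n)\<^sup>2)" for r
  proof -
    have "\<bar>p * (cos r)\<^sup>2 - 1\<bar> \<le> p * (cos r)\<^sup>2 + 1"
      using p by (simp add: abs_le_iff)
    also have "\<dots> \<le> p * 1 + 1"
      using p by (intro add_mono mult_left_mono) (auto simp: abs_square_le_1)
    finally have 1: "\<bar>p * (cos r)\<^sup>2 - 1\<bar> \<le> p + 1" by simp
    have "(sin (real n * r))\<^sup>2 \<le> (real n * \<bar>sin r\<bar>)\<^sup>2"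
      using power_mono[OF abs_sin_nat_mult_le[of n r], of 2] by simp
    then have "\<bar>(1 - cos (2 * real n * r)) / (sin r)\<^sup>2\<bar> \<le> 2 * (real n)\<^sup>2"
      using one_minus_cos_double[of "real n * r"]
      by (cases "sin r = 0") (simp_all add: field_simps power_mult_distrib)
    with 1 p show ?thesis
      unfolding g_def abs_mult by (intro mult_mono) auto
  qed
  then have "set_integrable lborel {0..pi} (\<lambda>r. sin r powr (p - 2) * g r)"
    using p by (intro set_integrable_mult_bounded[OF sin_powr_integrable]) (auto simp: g_def)
  moreover have "sin r powr (p - 2) * g r = Mn_integrand n p r" if "r \<in> {0..pi}" for r
  proof (cases "sin r = 0")
    case False
    with that have s: "0 < sin r" by (simp add: sin_ge_zero less_le)
    have "sin r powr (p - 2) = sin r powr ((p - 4) + 2)" by simp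
    also have "\<dots> = sin r powr (p - 4) * (sin r)\<^sup>2"
      using s by (simp only: powr_add) simp
    finally show ?thesis
      using s by (simp add: g_def Mn_integrand_def)
  qed (simp add: Mn_integrand_def)
  then have "set_integrable lborel {0..pi} (\<lambda>r. sin r powr (p - 2) * g r) \<longleftrightarrow>
      set_integrable lborel {0..pi} (Mn_integrand n p)"
    by (intro set_integrable_cong) auto
  ultimately show ?thesis by simp
qed

definition sin_moment :: "real \<Rightarrow> nat \<Rightarrow> real" where
  "sin_moment q n = (LBINT r:{0..pi}. sin r powr q * cos (2 * real n * r))"

definition Mn_integral :: "real \<Rightarrow> nat \<Rightarrow> real" where
  "Mn_integral p n = (LBINT r:{0..pi}. Mn_integrand n p r)"

lemma sin_moment_integrable:
  assumes "-1 < q"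
  shows "set_integrable lborel {0..pi} (\<lambda>r. sin r powr q * cos (2 * real n * r))"
  using assms by (intro set_integrable_mult_bounded[OF sin_powr_integrable, where B = 1]) auto

text \<open>This integrates the derivative of \<open>sin\<^sup>q\<^sup>+\<^sup>1 r cos (2n+1)r\<close>, which vanishes at both ends.\<close>

lemma sin_moment_Suc:
  assumes q: "-1 < q"
  shows "(q / 2 + real n + 1) * sin_moment q (Suc n) = (real n - q / 2) * sin_moment q n"
proof -
  define f where "f = (\<lambda>r. (q / 2 + real n + 1) * (sin r powr q * cos (2 * real (Suc n) * r))
      - (real n - q / 2) * (sin r powr q * cos (2 * real n * r)))"
  define F where "F = (\<lambda>r. sin r powr (q + 1) * cos ((2 * real n + 1) * r))"
  have "(LBINT r:{0..pi}. f r) = F pi - F 0"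
  proof (rule LBINT_FTC_interior)
    show "continuous_on {0..pi} F"
      unfolding F_def using q by (intro continuous_on_mult continuous_on_sin_powr continuous_intros) auto
    show "set_integrable lborel {0..pi} f"
      unfolding f_def using q
      by (intro set_integral_diff(1) set_integrable_mult_right sin_moment_integrable) auto
    fix r :: real assume "0 < r" "r < pi"
    then have s: "0 < sin r" by (auto intro: sin_gt_zero)
    have pw: "sin r powr (q + 1) = sin r powr q * sin r"
      using s by (simp add: powr_add)
    have tr: "cos (2 * real (Suc n) * r) = cos ((2 * real n + 1) * r) * cos r - sin ((2 * real n + 1) * r) * sin r"
       "cos (2 * real n * r) = cos ((2 * real n + 1) * r) * cos r + sin ((2 * real n + 1) * r) * sin r"
      by (simp_all add: cos_add[symmetric] cos_diff[symmetric] algebra_simps)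
    have "((\<lambda>r. cos ((2 * real n + 1) * r)) has_real_derivative
            - (2 * real n + 1) * sin ((2 * real n + 1) * r)) (at r)"
      by (auto intro!: derivative_eq_intros simp: algebra_simps)
    from DERIV_mult[OF DERIV_sin_powr[OF s, of "q + 1"] this]
    have "(F has_real_derivative (q + 1) * sin r powr (q + 1 - 1) * cos r * cos ((2 * real n + 1) * r) +
       - (2 * real n + 1) * sin ((2 * real n + 1) * r) * sin r powr (q + 1)) (at r)"
      unfolding F_def .
    also have "(q + 1) * sin r powr (q + 1 - 1) * cos r * cos ((2 * real n + 1) * r) +
       - (2 * real n + 1) * sin ((2 * real n + 1) * r) * sin r powr (q + 1) = f r"
      unfolding f_def pw tr by (simp add: algebra_simps)
    finally show "(F has_real_derivative f r) (at r)" .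
  qed auto
  moreover have "F pi = 0" "F 0 = 0" by (simp_all add: F_def)
  moreover have "(LBINT r:{0..pi}. f r) =
     (q / 2 + real n + 1) * sin_moment q (Suc n) - (real n - q / 2) * sin_moment q n"
    unfolding f_def sin_moment_def using q
    by (subst set_integral_diff(2))
      (auto simp del: of_nat_Suc intro!: sin_moment_integrable)
  ultimately show ?thesis by simp
qed

text \<open>With \<open>k\<close> for the middle index, taking second differences replaces the factor \<open>1 - cos 2nr\<close> by
  \<open>4 sin\<^sup>2 r cos 2kr\<close>. This creates the factor \<open>sin\<^sup>p\<^sup>-\<^sup>2 r (p cos\<^sup>2 r - 1) = (sin\<^sup>p\<^sup>-\<^sup>1 r cos r)'\<close>, and
  two integrations by parts lead to the moment, since \<open>sin\<^sup>p\<^sup>-\<^sup>1 r cos r\<close> is itself the derivative of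
  \<open>sin\<^sup>p r / p\<close>. The function \<open>F\<close> in the proof collects the boundary terms of these two integrations.\<close>

lemma Mn_integral_second_difference:
  assumes p: "1 < p"
  shows "Mn_integral p (Suc (Suc n)) - 2 * Mn_integral p (Suc n) + Mn_integral p n =
    - (16 * (real (Suc n))\<^sup>2 / p) * sin_moment p (Suc n)"
proof -
  define k where "k = real (Suc n)"
  define f where "f = (\<lambda>r. Mn_integrand (Suc (Suc n)) p r - 2 * Mn_integrand (Suc n) p r
      + Mn_integrand n p r + (16 * k\<^sup>2 / p) * (sin r powr p * cos (2 * k * r)))"
  define F where "F = (\<lambda>r. 4 * (sin r powr (p - 1) * (cos r * cos (2 * k * r)))
      + (8 * k / p) * (sin r powr p * sin (2 * k * r)))"
  have int: "set_integrable lborel {0..pi} (\<lambda>r. sin r powr p * cos (2 * k * r))"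
    using p unfolding k_def by (intro sin_moment_integrable) auto
  note ints = int Mn_integrand_integrable[OF p]
  have "(LBINT r:{0..pi}. f r) = F pi - F 0"
  proof (rule LBINT_FTC_interior)
    show "continuous_on {0..pi} F"
      unfolding F_def using p
      by (intro continuous_on_mult continuous_on_sin_powr continuous_on_add continuous_intros) auto
    show "set_integrable lborel {0..pi} f"
      unfolding f_def
      by (intro set_integral_add(1) set_integral_diff(1) set_integrable_mult_right ints)
    fix r :: real assume "0 < r" "r < pi"
    then have s: "0 < sin r" by (auto intro: sin_gt_zero)
    define P where "P = sin r powr (p - 4)"
    have pw: "sin r powr p = P * sin r ^ 4" "sin r powr (p - 1) = P * sin r ^ 3"
      "sin r powr (p - 1 - 1) = P * sin r ^ 2"
      using s powr_add[of "sin r" "p - 4" "real 4"] powr_add[of "sin r" "p - 4" "real 3"]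
        powr_add[of "sin r" "p - 4" "real 2"]
      unfolding P_def by (simp_all only: powr_realpow) simp_all
    have k2: "2 * real (Suc (Suc n)) * r = 2 * k * r + 2 * r" "2 * real n * r = 2 * k * r - 2 * r"
      by (simp_all add: k_def algebra_simps)
    have f: "f r = 
       P * (p * (cos r)\<^sup>2 - 1) * (2 * cos (2 * k * r) * (1 - cos (2 * r))) +
       (16 * k\<^sup>2 / p) * (P * sin r ^ 4 * cos (2 * k * r))"
      unfolding f_def Mn_integrand_def k2 cos_add cos_diff pw P_def[symmetric] k_def[symmetric]
      by (simp add: algebra_simps)
    have 1: "((\<lambda>r. cos r * cos (2 * k * r)) has_real_derivative
            - sin r * cos (2 * k * r) + - (2 * k) * sin (2 * k * r) * cos r) (at r)"
      by (auto intro!: derivative_eq_intros)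
    have 2: "((\<lambda>r. sin (2 * k * r)) has_real_derivative 2 * k * cos (2 * k * r)) (at r)"
      by (auto intro!: derivative_eq_intros)
    have alg: "4 * ((p - 1) * (P * s ^ 2) * c * (c * X) + (- s * X + - (2 * k) * Y * c) * (P * s ^ 3)) +
        (8 * k / p) * (p * (P * s ^ 3) * c * Y + 2 * k * X * (P * s ^ 4)) =
        4 * P * s\<^sup>2 * X * ((p - 1) * c\<^sup>2 - s\<^sup>2) + (16 * k\<^sup>2 / p) * (P * s ^ 4 * X)"
      for s c X Y :: real
      using p by (simp add: field_simps eval_nat_numeral)
    have "(F has_real_derivative
       4 * ((p - 1) * sin r powr (p - 1 - 1) * cos r * (cos r * cos (2 * k * r)) +
         (- sin r * cos (2 * k * r) + - (2 * k) * sin (2 * k * r) * cos r) * sin r powr (p - 1)) +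
       (8 * k / p) * (p * sin r powr (p - 1) * cos r * sin (2 * k * r) +
         2 * k * cos (2 * k * r) * sin r powr p)) (at r)"
      unfolding F_def
      by (intro DERIV_add DERIV_cmult DERIV_mult[OF DERIV_sin_powr[OF s] 1]
          DERIV_mult[OF DERIV_sin_powr[OF s] 2])
    also have "4 * ((p - 1) * sin r powr (p - 1 - 1) * cos r * (cos r * cos (2 * k * r)) +
         (- sin r * cos (2 * k * r) + - (2 * k) * sin (2 * k * r) * cos r) * sin r powr (p - 1)) +
       (8 * k / p) * (p * sin r powr (p - 1) * cos r * sin (2 * k * r) +
         2 * k * cos (2 * k * r) * sin r powr p) =
       4 * P * (sin r)\<^sup>2 * cos (2 * k * r) * ((p - 1) * (cos r)\<^sup>2 - (sin r)\<^sup>2) +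
       (16 * k\<^sup>2 / p) * (P * sin r ^ 4 * cos (2 * k * r))"
      unfolding pw by (rule alg)
    also have "\<dots> = f r"
      unfolding f one_minus_cos_double using sin_cos_squared_add[of r] by algebra
    finally show "(F has_real_derivative f r) (at r)" .
  qed auto
  moreover have "F pi = 0" "F 0 = 0" using p by (simp_all add: F_def)
  moreover have "(LBINT r:{0..pi}. f r) = Mn_integral p (Suc (Suc n)) - 2 * Mn_integral p (Suc n) + Mn_integral p n
     + (16 * k\<^sup>2 / p) * sin_moment p (Suc n)"
    unfolding f_def sin_moment_def Mn_integral_def k_def[symmetric]
    by (simp add: set_integral_add(2) set_integral_diff set_integrable_mult_right ints)
  ultimately show ?thesis by (simp add: k_def)
qed

lemma Mn_integral_0: "Mn_integral p 0 = 0"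
  by (simp add: Mn_integral_def Mn_integrand_def)

text \<open>Since \<open>1 - cos 2r = 2 sin\<^sup>2 r\<close>, the integrand is the derivative of \<open>2 sin\<^sup>p\<^sup>-\<^sup>1 r cos r\<close>, which vanishes
  at both ends.\<close>

lemma Mn_integral_1:
  assumes p: "1 < p"
  shows "Mn_integral p 1 = 0"
proof -
  define F where "F = (\<lambda>r. 2 * (sin r powr (p - 1) * cos r))"
  have "(LBINT r:{0..pi}. Mn_integrand 1 p r) = F pi - F 0"
  proof (rule LBINT_FTC_interior)
    show "continuous_on {0..pi} F"
      unfolding F_def using p by (intro continuous_on_mult continuous_on_sin_powr continuous_intros) auto
    fix r :: real assume "0 < r" "r < pi"
    then have s: "0 < sin r" by (auto intro: sin_gt_zero)
    define P where "P = sin r powr (p - 4)"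
    have pw: "sin r powr (p - 1) = P * sin r ^ 3" "sin r powr (p - 1 - 1) = P * sin r ^ 2"
      using s powr_add[of "sin r" "p - 4" "real 3"] powr_add[of "sin r" "p - 4" "real 2"]
      unfolding P_def by (simp_all only: powr_realpow) simp_all
    have "(F has_real_derivative
        2 * ((p - 1) * sin r powr (p - 1 - 1) * cos r * cos r + - sin r * sin r powr (p - 1))) (at r)"
      unfolding F_def by (intro DERIV_cmult DERIV_mult[OF DERIV_sin_powr[OF s] DERIV_cos])
    also have "2 * ((p - 1) * sin r powr (p - 1 - 1) * cos r * cos r + - sin r * sin r powr (p - 1)) =
        P * (p * (cos r)\<^sup>2 - 1) * (1 - cos (2 * r))"
      unfolding pw one_minus_cos_double using sin_cos_squared_add[of r] by algebra
    finally show "(F has_real_derivative Mn_integrand 1 p r) (at r)"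
      by (simp add: Mn_integrand_def P_def)
  qed (auto intro: Mn_integrand_integrable p)
  then show ?thesis by (simp add: F_def Mn_integral_def)
qed



section \<open>The explicit solution of the difference equation\<close>

text \<open>Here \<open>a = p/2\<close>. In terms of the Gamma function the weight is
  \<open>\<Gamma>(m+2-a) \<Gamma>(a) / (\<Gamma>(2-a) \<Gamma>(m+2+a))\<close> (for \<open>a\<close> where this makes sense), hence of order \<open>m\<^sup>-\<^sup>2\<^sup>a\<close>.
  The index is shifted by one: the weight at \<open>m\<close> belongs to the step of the multipliers from
  \<open>m + 1\<close> to \<open>m + 2\<close>. The recursion form has no poles, so it serves every \<open>a > 0\<close>.\<close>

fun decay_weight :: "real \<Rightarrow> nat \<Rightarrow> real" where
  "decay_weight a 0 = 1 / (a * (a + 1))"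
| "decay_weight a (Suc m) = decay_weight a m * ((real m + 2 - a) / (real m + 2 + a))"

text \<open>Up to a factor independent of \<open>m\<close>, the difference of the multipliers with indices \<open>m + 2\<close> and
  \<open>m + 1\<close>.\<close>

definition increment :: "real \<Rightarrow> nat \<Rightarrow> real" where
  "increment a m = (real m + 1) * (real m + 2) * decay_weight a m"

lemma decay_weight_pos:
  assumes "0 < a" "a < 2"
  shows "0 < decay_weight a m"
  using assms by (induction m) auto

lemma increment_Suc:
  assumes a: "0 < a"
  shows "increment a (Suc m) - increment a m =
     2 * (real m + 2)\<^sup>2 * (1 - a) * decay_weight a m / (real m + 2 + a)"
  using a unfolding increment_def by (simp add: divide_simps) algebra

text \<open>Each factor \<open>(x-a)/(x+a)\<close> of the weight is at most \<open>exp (-2a/x)\<close>, because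
  \<open>ln ((1+u)/(1-u)) \<ge> 2u\<close>, and \<open>exp (-1/x) \<le> x/(x+1)\<close>. The product of the bounds telescopes.\<close>

lemma decay_weight_upper:
  assumes a: "0 < a" "a < 2"
  shows "decay_weight a m \<le> decay_weight a 0 * (2 / (real m + 2)) powr (2 * a)"
proof (induction m)
  case 0
  show ?case using a by simp
next
  case (Suc m)
  define x where "x = real m + 2"
  have x: "2 \<le> x" by (simp add: x_def)
  have "(x - a) / (x + a) \<le> (x / (x + 1)) powr (2 * a)"
  proof -
    have 1: "2 * (a / x) \<le> ln ((1 + a / x) / (1 - a / x))"
    proof -
      define u where "u = a / x"
      have u: "0 \<le> u" "u < 1" using a x by (auto simp: u_def field_simps)
      let ?g = "\<lambda>u::real. ln (1 + u) - ln (1 - u) - 2 * u"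
      have "?g 0 \<le> ?g u"
      proof (rule DERIV_nonneg_imp_nondecreasing[OF u(1)])
        fix t assume t: "0 \<le> t" "t \<le> u"
        have "(?g has_real_derivative 1 / (1 + t) + 1 / (1 - t) - 2) (at t)"
          using t u by (auto intro!: derivative_eq_intros)
        moreover have "0 \<le> 1 / (1 + t) + 1 / (1 - t) - 2"
          using t u by (simp add: divide_simps) (simp add: algebra_simps)
        ultimately show "\<exists>y. (?g has_real_derivative y) (at t) \<and> 0 \<le> y" by blast
      qed
      then have "2 * u \<le> ln ((1 + u) / (1 - u))" using u by (simp add: ln_div)
      then show ?thesis by (simp add: u_def)
    qed
    have 2: "(1 + a / x) / (1 - a / x) = (x + a) / (x - a)"
      using a x by (simp add: field_simps)
    have 3: "ln ((x + 1) / x) \<le> 1 / x"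
      using ln_add_one_self_le_self[of "1 / x"] x by (simp add: field_simps)
    have "ln ((x - a) / (x + a)) = - ln ((x + a) / (x - a))"
      using a x by (simp add: ln_div)
    also have "\<dots> \<le> - (2 * a * (1 / x))" using 1 2 by simp
    also have "\<dots> \<le> - (2 * a * ln ((x + 1) / x))"
      using mult_left_mono[OF 3, of "2 * a"] a by simp
    also have "\<dots> = ln ((x / (x + 1)) powr (2 * a))"
      using x by (simp add: ln_powr ln_div algebra_simps)
    finally show ?thesis using a x by (subst (asm) ln_le_cancel_iff) auto
  qed
  then have "decay_weight a m * ((x - a) / (x + a)) \<le>
     (decay_weight a 0 * (2 / x) powr (2 * a)) * (x / (x + 1)) powr (2 * a)"
    using Suc a x by (intro mult_mono) (auto simp: x_def)
  also have "\<dots> = decay_weight a 0 * (2 / (x + 1)) powr (2 * a)"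
    using x by (simp add: powr_mult[symmetric] del: decay_weight.simps)
  finally show ?case by (simp add: x_def add_ac)
qed

text \<open>The difference of the logarithms of the two sides is concave in \<open>a\<close> and vanishes at \<open>a = 0\<close>, so it
  suffices to look at \<open>a = 3/2\<close>. There the claim becomes \<open>(x-2)(3x-1) + 1 \<ge> 0\<close>.\<close>

lemma ratio_lower:
  assumes a: "0 \<le> a" "a \<le> 3/2" and x: "2 \<le> (x::real)"
  shows "((x - 1) / x) powr (2 * a) \<le> (x - a) / (x + a)"
proof -
  let ?f = "\<lambda>a. ln (x - a) - ln (x + a) - 2 * a * ln ((x - 1) / x)"
  have "concave_on {0..3/2} ?f"
  proof (rule f''_le0_imp_concave)
    fix t :: real assume t: "t \<in> {0..3/2}"
    show "(?f has_real_derivative - (1 / (x - t)) - 1 / (x + t) - 2 * ln ((x - 1) / x)) (at t)"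
      using t x by (auto intro!: derivative_eq_intros)
    show "((\<lambda>t. - (1 / (x - t)) - 1 / (x + t) - 2 * ln ((x - 1) / x)) has_real_derivative
       - (1 / (x - t)\<^sup>2) + 1 / (x + t)\<^sup>2) (at t)"
      using t x by (auto intro!: derivative_eq_intros simp: power2_eq_square)
    have "(x - t)\<^sup>2 \<le> (x + t)\<^sup>2" using t x by (intro power_mono) auto
    then have "1 / (x + t)\<^sup>2 \<le> 1 / (x - t)\<^sup>2" using t x by (intro divide_left_mono) auto
    then show "- (1 / (x - t)\<^sup>2) + 1 / (x + t)\<^sup>2 \<le> 0" by simp
  qed auto
  moreover have f: "0 \<le> ?f (3/2)"
  proof -
    have "0 \<le> (x - 2) * (3 * x - 1) + 1"
      using x by simp
    also have "(x - 2) * (3 * x - 1) + 1 = 3 * (x * x) - 7 * x + 3"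
      by (simp add: algebra_simps)
    finally have "((x - 1) / x) ^ 3 \<le> (x - 3/2) / (x + 3/2)"
      using x by (simp add: power_divide divide_simps) (simp add: eval_nat_numeral algebra_simps)
    then have "ln (((x - 1) / x) ^ 3) \<le> ln ((x - 3/2) / (x + 3/2))"
      using x by (subst ln_le_cancel_iff) auto
    then show ?thesis using x by (simp add: ln_realpow ln_div)
  qed
  ultimately have "(?f (3/2) - ?f 0) / (3/2 - 0) * (a - 0) + ?f 0 \<le> ?f a"
    using a by (intro concave_onD_Icc') auto
  moreover have "0 \<le> (?f (3/2) - ?f 0) / (3/2 - 0) * (a - 0) + ?f 0"
    using f a by simp
  ultimately have "0 \<le> ?f a" by (rule order_trans[rotated])
  then have "ln (((x - 1) / x) powr (2 * a)) \<le> ln ((x - a) / (x + a))"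
    using a x by (simp add: ln_powr ln_div)
  then show ?thesis using a x by (subst (asm) ln_le_cancel_iff) auto
qed

lemma decay_weight_lower:
  assumes a: "0 < a" "a \<le> 3 / 2"
  shows "decay_weight a 0 * (1 / (real m + 1)) powr (2 * a) \<le> decay_weight a m"
proof (induction m)
  case 0
  show ?case using a by simp
next
  case (Suc m)
  define x where "x = real m + 2"
  have x: "2 \<le> x" by (simp add: x_def)
  have "decay_weight a 0 * (1 / x) powr (2 * a) =
     (decay_weight a 0 * (1 / (x - 1)) powr (2 * a)) * ((x - 1) / x) powr (2 * a)"
    using x by (simp add: powr_mult[symmetric] del: decay_weight.simps)
  also have "\<dots> \<le> decay_weight a m * ((x - a) / (x + a))"
    using Suc a x ratio_lower[of a x] decay_weight_pos[of a m]
    by (intro mult_mono) (simp_all add: x_def add.commute del: decay_weight.simps)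
  finally show ?case by (simp add: x_def add_ac)
qed


text \<open>The increments are Gosper summable. The closed form carries the factor \<open>2a - 3\<close> and hence says
  nothing about the sum at \<open>a = 3/2\<close>, but for \<open>2 \<le> a \<le> 3\<close> it gives the sign of the sum, which the
  signs of the increments alone do not.\<close>

lemma sum_increment_closed:
  assumes a: "0 < a"
  shows "(2 * a - 1) * (2 * a - 3) * (\<Sum>m<n. increment a m) =
    1 - decay_weight a n * ((real n + 1 + a) * ((real n + 1)\<^sup>2 * (2 * a - 1) - (a - 1)))"
proof (induction n)
  case 0
  have "1 / (a * (a + 1)) * ((1 + a) * (2 * a - 1 - (a - 1))) = 1"
    using a by (simp add: add.commute)
  then show ?case by simp
next
  case (Suc n)
  define V W where "V = decay_weight a n" and "W = decay_weight a (Suc n)"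
  have W: "V * (real n + 2 - a) = W * (real n + 2 + a)"
    using a by (simp add: V_def W_def)
  have "(2 * a - 1) * (2 * a - 3) * (\<Sum>m<Suc n. increment a m) =
      1 - V * ((real n + 1 + a) * ((real n + 1)\<^sup>2 * (2 * a - 1) - (a - 1)))
        + (2 * a - 1) * (2 * a - 3) * ((real n + 1) * (real n + 2) * V)"
    using Suc by (simp only: sum.lessThan_Suc distrib_left V_def increment_def)
  also have "\<dots> = 1 - W * ((real n + 2 + a) * ((real n + 2)\<^sup>2 * (2 * a - 1) - (a - 1)))"
    using W by algebra
  finally show ?case by (simp only: W_def of_nat_Suc) (simp add: add_ac)
qed

lemma decay_weight_Suc_nonpos:
  assumes a: "2 \<le> a" "a \<le> 3"
  shows "decay_weight a (Suc m) \<le> 0"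
proof (induction m)
  case 0
  have "0 < a * (a + 1)" using a by simp
  then show ?case using a by (auto simp: divide_nonneg_pos intro!: mult_nonneg_nonpos divide_nonpos_pos)
next
  case (Suc m)
  have "decay_weight a (Suc (Suc m)) =
      decay_weight a (Suc m) * ((real (Suc m) + 2 - a) / (real (Suc m) + 2 + a))" by simp
  also have "\<dots> \<le> 0" using a by (intro mult_nonpos_nonneg[OF Suc]) auto
  finally show ?case .
qed

lemma decay_weight_Suc_Suc_nonneg:
  assumes a: "3 \<le> a" "a \<le> 4"
  shows "0 \<le> decay_weight a (Suc (Suc m))"
proof (induction m)
  case 0
  have "0 < a * (a + 1) * (2 + a) * (3 + a)" using a by simp
  moreover have "0 \<le> (2 - a) * (3 - a)" using a by (intro mult_nonpos_nonpos) auto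
  ultimately have "0 \<le> ((2 - a) * (3 - a)) / (a * (a + 1) * (2 + a) * (3 + a))" by simp
  then show ?case by (simp add: mult_ac add_ac)
next
  case (Suc m)
  have "0 \<le> decay_weight a (Suc (Suc m)) * ((real (Suc (Suc m)) + 2 - a) / (real (Suc (Suc m)) + 2 + a))"
    using a by (intro mult_nonneg_nonneg[OF Suc]) auto
  then show ?case by simp
qed

section \<open>Nonnegativity of the multipliers\<close>

text \<open>For \<open>a < 2\<close> all increments are positive. For \<open>2 \<le> a \<le> 3\<close> only the first one is positive; the closed
  form is then at least \<open>1\<close>, since the weight in it is nonpositive. For \<open>3 < a < 4\<close> only the second
  increment can be negative, so the sum of the first two is the critical one; it equals
  \<open>(16 - 4a) / (a (a+1) (a+2))\<close> and changes sign at \<open>a = 4\<close>. This is where the bound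
  \<open>p < 8\<close> comes from.\<close>

lemma sum_increment_nonneg:
  assumes a: "1/2 < a" "a < 4"
  shows "0 \<le> (\<Sum>m<n. increment a m)"
proof -
  consider "a < 2" | "2 \<le> a" "a \<le> 3" | "3 < a" by linarith
  then show ?thesis
  proof cases
    case 1
    then show ?thesis
      using a decay_weight_pos[of a] by (auto intro!: sum_nonneg simp: increment_def less_imp_le)
  next
    case 2
    show ?thesis
    proof (cases n)
      case (Suc k)
      have "0 \<le> (real n + 1)\<^sup>2 * (2 * a - 1) - (a - 1)"
      proof -
        have "1 * (2 * a - 1) \<le> (real n + 1)\<^sup>2 * (2 * a - 1)"
          using a by (intro mult_right_mono) (auto simp: power2_eq_square algebra_simps)
        moreover have "a - 1 \<le> 1 * (2 * a - 1)" using a by simp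
        ultimately have "a - 1 \<le> (real n + 1)\<^sup>2 * (2 * a - 1)" by (rule order_trans[rotated])
        then show ?thesis by simp
      qed
      then have "decay_weight a n * ((real n + 1 + a) * ((real n + 1)\<^sup>2 * (2 * a - 1) - (a - 1))) \<le> 0"
        using decay_weight_Suc_nonpos[OF 2, of k] a Suc
        by (intro mult_nonpos_nonneg mult_nonneg_nonneg) auto
      then have "0 \<le> (2 * a - 1) * (2 * a - 3) * (\<Sum>m<n. increment a m)"
        using a by (subst sum_increment_closed) auto
      moreover have "0 < (2 * a - 1) * (2 * a - 3)" using 2 by simp
      ultimately show ?thesis by (simp add: zero_le_mult_iff)
    qed simp
  next
    case 3
    have two: "(\<Sum>m<2. increment a m) = (16 - 4 * a) / (a * (a + 1) * (a + 2))"
      using a by (simp add: eval_nat_numeral increment_def divide_simps)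
    show ?thesis
    proof (cases "n \<le> 1")
      case True
      then have "n = 0 \<or> n = 1" by auto
      then show ?thesis using a by (auto simp: increment_def)
    next
      case False
      have "0 \<le> (\<Sum>m<2. increment a m)" unfolding two using a by simp
      also have "\<dots> \<le> (\<Sum>m<n. increment a m)"
      proof (rule sum_mono2)
        fix m assume "m \<in> {..<n} - {..<2}"
        then obtain k where "m = Suc (Suc k)" by (metis DiffE lessThan_iff not_less add_2_eq_Suc le_Suc_ex)
        then show "0 \<le> increment a m"
          using decay_weight_Suc_Suc_nonneg[of a k] 3 a by (simp add: increment_def del: decay_weight.simps)
      qed (use False in auto)
      finally show ?thesis .
    qed
  qed
qed

section \<open>Growth of the multipliers\<close>

text \<open>For \<open>0 < t \<le> 1\<close> and \<open>e \<le> 1\<close> one has \<open>t\<^sup>e \<ge> t\<close>. With \<open>t = m/N\<close> this compares the sum with an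
  arithmetic progression, for both signs of \<open>e\<close>.\<close>

lemma sum_powr_lower:
  assumes e: "e \<le> 1" and n: "1 \<le> n"
  shows "real (Suc n) powr (e + 1) / 4 \<le> (\<Sum>m<n. real (Suc m) powr e)"
proof -
  define N where "N = real (Suc n)"
  have N: "2 \<le> N" using n by (simp add: N_def)
  have sm: "(\<Sum>m<n. real (Suc m)) = N * (N - 1) / 2"
    unfolding N_def by (induction n) (auto simp: field_simps)
  have "N powr (e + 1) / 4 \<le> N powr e * (N - 1) / 2"
    using N by (simp add: powr_add field_simps)
  also have "\<dots> = N powr e * ((\<Sum>m<n. real (Suc m)) / N)"
    using N unfolding sm by simp
  also have "\<dots> = (\<Sum>m<n. N powr e * (real (Suc m) / N))"
    by (simp add: sum_distrib_left sum_divide_distrib)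
  also have "\<dots> \<le> (\<Sum>m<n. real (Suc m) powr e)"
  proof (rule sum_mono)
    fix m assume "m \<in> {..<n}"
    then have m: "0 < real (Suc m) / N" "real (Suc m) / N \<le> 1" by (auto simp: N_def)
    have "(real (Suc m) / N) powr 1 \<le> (real (Suc m) / N) powr e"
      using m e by (intro powr_mono') auto
    then have "real (Suc m) / N \<le> (real (Suc m) / N) powr e"
      using m N by (simp del: of_nat_Suc)
    from mult_left_mono[OF this]
    have "N powr e * (real (Suc m) / N) \<le> N powr e * (real (Suc m) / N) powr e"
      by simp
    also have "\<dots> = real (Suc m) powr e"
      using N by (simp add: powr_mult[symmetric])
    finally show "N powr e * (real (Suc m) / N) \<le> real (Suc m) powr e" .
  qed
  finally show ?thesis by (simp add: N_def)
qed

text \<open>A discrete form of \<open>\<integral>\<^bsub>x-1\<^esub>\<^bsup>x\<^esup> t y\<^sup>t\<^sup>-\<^sup>1 dy\<close>, valid for concave and convex powers alike: with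
  \<open>v = t/x \<le> 1\<close> one has \<open>(1 - 1/x)\<^sup>t \<le> exp (-v) \<le> 1/(1+v) \<le> 1 - v/2\<close>.\<close>

lemma powr_difference_lower:
  assumes t: "0 < t" "t < 2" and x: "2 \<le> (x::real)"
  shows "t / 2 * x powr (t - 1) \<le> x powr t - (x - 1) powr t"
proof -
  define v where "v = t / x"
  have v: "0 < v" "v < 1" using t x by (auto simp: v_def)
  have "ln (1 - 1 / x) \<le> - (1 / x)"
    using ln_add_one_self_le_self2[of "- (1 / x)"] x by simp
  then have "t * ln (1 - 1 / x) \<le> - v"
    using t mult_left_mono[of "ln (1 - 1 / x)" "- (1 / x)" t] by (simp add: v_def)
  then have "(1 - 1 / x) powr t \<le> exp (- v)"
    using x by (simp add: powr_def)
  also have "\<dots> \<le> 1 / (1 + v)"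
    using v exp_ge_add_one_self[of v] by (simp add: exp_minus field_simps)
  also have "\<dots> \<le> 1 - v / 2"
    using v mult_left_mono[of v 1 v] by (simp add: field_simps)
  finally have "x powr t * (1 - 1 / x) powr t \<le> x powr t * (1 - v / 2)"
    by (intro mult_left_mono) auto
  moreover have "x powr t * (1 - 1 / x) powr t = (x - 1) powr t"
  proof -
    have "x * (1 - 1 / x) = x - 1" using x by (simp add: field_simps)
    then show ?thesis using x by (simp add: powr_mult[symmetric])
  qed
  moreover have "x powr t * (1 - v / 2) = x powr t - t / 2 * x powr (t - 1)"
    using x by (simp add: v_def powr_diff field_simps)
  ultimately show ?thesis by linarith
qed

lemma sum_powr_upper:
  assumes t: "0 < t" "t < 2"
  shows "(\<Sum>m<n. (real m + 2) powr (t - 1)) \<le> 2 / t * real (Suc n) powr t"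
proof -
  have "t / 2 * (\<Sum>m<n. (real m + 2) powr (t - 1)) \<le> real (Suc n) powr t - 1"
  proof (induction n)
    case (Suc n)
    then show ?case
      using powr_difference_lower[OF t, of "real n + 2"] by (simp add: distrib_left add_ac)
  qed simp
  then have "t / 2 * (\<Sum>m<n. (real m + 2) powr (t - 1)) \<le> real (Suc n) powr t" by simp
  then show ?thesis using t by (simp add: field_simps)
qed

text \<open>The increment at \<open>m\<close> is of order \<open>m\<^sup>2 m\<^sup>-\<^sup>2\<^sup>a\<close>. The sum of these powers is of order \<open>n\<^sup>3\<^sup>-\<^sup>2\<^sup>a\<close> as long as
  \<open>a < 3/2\<close>; the constant of the upper bound degenerates there, that of the lower bound does not.\<close>

lemma sum_increment_bounds:
  assumes a: "1/2 < a" "a < 3/2" and n: "1 \<le> n"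
  defines "V \<equiv> 1 / (a * (a + 1))"
  shows "V / 4 * real (Suc n) powr (3 - 2 * a) \<le> (\<Sum>m<n. increment a m)"
    and "(\<Sum>m<n. increment a m) \<le> V * 2 powr (2 * a) * (2 / (3 - 2 * a)) * real (Suc n) powr (3 - 2 * a)"
proof -
  have V: "0 < V" "V = decay_weight a 0" using a by (simp_all add: V_def)
  have lo: "V * real (Suc m) powr (2 - 2 * a) \<le> increment a m" for m
  proof -
    have "real (Suc m) powr (2 - 2 * a) = (real (Suc m))\<^sup>2 * (1 / (real m + 1)) powr (2 * a)"
      by (simp add: powr_diff powr_divide add_ac)
    then have "V * real (Suc m) powr (2 - 2 * a) = (real (Suc m))\<^sup>2 * (V * (1 / (real m + 1)) powr (2 * a))"
      by simp
    also have "\<dots> \<le> ((real m + 1) * (real m + 2)) * decay_weight a m"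
      using a V decay_weight_lower[of a m]
      by (intro mult_mono) (auto simp: power2_eq_square algebra_simps simp del: decay_weight.simps)
    finally show ?thesis by (simp add: increment_def)
  qed
  have hi: "increment a m \<le> V * 2 powr (2 * a) * (real m + 2) powr (3 - 2 * a - 1)" for m
  proof -
    have "increment a m \<le> (real m + 2)\<^sup>2 * (V * (2 / (real m + 2)) powr (2 * a))"
      unfolding increment_def using a V decay_weight_upper[of a m] decay_weight_pos[of a m]
      by (intro mult_mono) (auto simp: power2_eq_square algebra_simps simp del: decay_weight.simps)
    also have "\<dots> = V * 2 powr (2 * a) * (real m + 2) powr (2 - 2 * a)"
      by (simp add: powr_diff powr_divide)
    finally show ?thesis by simp
  qed
  have "V / 4 * real (Suc n) powr (3 - 2 * a) = V * (real (Suc n) powr (2 - 2 * a + 1) / 4)"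
    by simp
  also have "\<dots> \<le> V * (\<Sum>m<n. real (Suc m) powr (2 - 2 * a))"
    using V a n by (intro mult_left_mono sum_powr_lower) auto
  also have "\<dots> \<le> (\<Sum>m<n. increment a m)"
    unfolding sum_distrib_left by (intro sum_mono lo)
  finally show "V / 4 * real (Suc n) powr (3 - 2 * a) \<le> (\<Sum>m<n. increment a m)" .
  have "(\<Sum>m<n. increment a m) \<le> V * 2 powr (2 * a) * (\<Sum>m<n. (real m + 2) powr (3 - 2 * a - 1))"
    unfolding sum_distrib_left by (intro sum_mono hi)
  also have "\<dots> \<le> V * 2 powr (2 * a) * (2 / (3 - 2 * a) * real (Suc n) powr (3 - 2 * a))"
    using V a by (intro mult_left_mono sum_powr_upper) auto
  finally show "(\<Sum>m<n. increment a m) \<le> V * 2 powr (2 * a) * (2 / (3 - 2 * a)) * real (Suc n) powr (3 - 2 * a)"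
    by (simp add: mult.assoc)
qed



section \<open>Formula and bounds for the multipliers\<close>

text \<open>The product form of the weight starts with the factor \<open>2 - a\<close>. The two earlier factors \<open>-a\<close> and
  \<open>1 - a\<close> of the moment stand in front of it, which is why the formula begins at index \<open>2\<close>.\<close>

lemma sin_moment_eq_decay_weight:
  assumes p: "0 < p"
  defines "a \<equiv> p / 2"
  shows "sin_moment p (Suc (Suc m)) =
    - sin_moment p 0 * a\<^sup>2 * (1 - a) * decay_weight a m / (real m + 2 + a)"
proof (induction m)
  case 0
  have a: "0 < a" using p by (simp add: a_def)
  have 1: "sin_moment p (Suc 0) = - a / (a + 1) * sin_moment p 0"
    using sin_moment_Suc[of p 0] p a by (simp add: a_def[symmetric] field_simps)
  have 2: "sin_moment p (Suc (Suc 0)) = (1 - a) / (a + 2) * sin_moment p (Suc 0)"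
    using sin_moment_Suc[of p 1] p a by (simp add: a_def[symmetric] field_simps)
  show ?case
    unfolding 2 1 using a by (simp add: power2_eq_square add_ac mult_ac)
next
  case (Suc m)
  have a: "0 < a" using p by (simp add: a_def)
  have "sin_moment p (Suc (Suc (Suc m))) =
      (real m + 2 - a) / (real m + 3 + a) * sin_moment p (Suc (Suc m))"
    using sin_moment_Suc[of p "Suc (Suc m)"] p a by (simp add: a_def[symmetric] field_simps)
  then show ?case
    unfolding Suc using a by (simp add: add_ac mult_ac)
qed

text \<open>The first differences of the multipliers and the increments have the same differences
  (\<open>increment_Suc\<close> against the second difference formula) and agree at the first index, so they are
  proportional.\<close>

lemma Mn_integral_eq_sum_increment:
  assumes p: "1 < p"
  shows "Mn_integral p (Suc n) = 2 * p * sin_moment p 0 * (\<Sum>m<n. increment (p / 2) m)"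
proof -
  define a where "a = p / 2"
  have a: "0 < a" "p = 2 * a" using p by (simp_all add: a_def)
  have step: "Mn_integral p (Suc (Suc m)) - Mn_integral p (Suc m) = 4 * a * sin_moment p 0 * increment a m" for m
  proof (induction m)
    case 0
    have 1: "sin_moment p (Suc 0) = - a / (a + 1) * sin_moment p 0"
      using sin_moment_Suc[of p 0] p a by (simp add: field_simps)
    have "Mn_integral p (Suc (Suc 0)) = 8 * sin_moment p 0 / (a + 1)"
      using Mn_integral_second_difference[OF p, of 0] Mn_integral_0[of p] Mn_integral_1[OF p] a
      unfolding 1 by (simp add: field_simps)
    then show ?case
      using Mn_integral_1[OF p] a by (simp add: increment_def)
  next
    case (Suc m)
    have "Mn_integral p (Suc (Suc (Suc m))) - Mn_integral p (Suc (Suc m)) =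
        (Mn_integral p (Suc (Suc m)) - Mn_integral p (Suc m)) - (16 * (real m + 2)\<^sup>2 / p) * sin_moment p (Suc (Suc m))"
      using Mn_integral_second_difference[OF p, of "Suc m"] by (simp add: add_ac)
    also have "(16 * (real m + 2)\<^sup>2 / p) * sin_moment p (Suc (Suc m)) =
        - (4 * a * sin_moment p 0 * (increment a (Suc m) - increment a m))"
      using a p unfolding increment_Suc[OF a(1)]
      by (simp add: sin_moment_eq_decay_weight power2_eq_square)
    finally show ?case
      unfolding Suc by (simp add: algebra_simps)
  qed
  have "Mn_integral p (Suc n) = (\<Sum>m<n. 4 * a * sin_moment p 0 * increment a m)"
  proof (induction n)
    case 0
    show ?case using Mn_integral_1[OF p] by simp
  next
    case (Suc n)
    then show ?case using step[of n] by simp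
  qed
  then show ?thesis by (simp add: sum_distrib_left a)
qed

lemma sin_moment_3_0: "sin_moment 3 0 = 4 / 3"
proof -
  have "(LBINT r:{0..pi}. sin r powr 3) = (cos pi ^ 3 / 3 - cos pi) - (cos 0 ^ 3 / 3 - cos 0)"
  proof (rule LBINT_FTC_interior)
    fix r :: real assume "0 < r" "r < pi"
    then have s: "0 < sin r" by (auto intro: sin_gt_zero)
    have "((\<lambda>r. cos r ^ 3 / 3 - cos r) has_real_derivative sin r * (1 - (cos r)\<^sup>2)) (at r)"
      by (auto intro!: derivative_eq_intros simp: algebra_simps)
    also have "1 - (cos r)\<^sup>2 = (sin r)\<^sup>2" by (simp add: sin_squared_eq)
    also have "sin r * (sin r)\<^sup>2 = sin r powr 3"
      using s by (simp add: eval_nat_numeral)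
    finally show "((\<lambda>r. cos r ^ 3 / 3 - cos r) has_real_derivative sin r powr 3) (at r)" .
  qed (auto intro!: continuous_intros sin_powr_integrable)
  then show ?thesis by (simp add: sin_moment_def)
qed

text \<open>The lower bound compares \<open>sin\<^sup>p\<close> with \<open>sin\<^sup>3\<close>; what matters is that it does not depend on \<open>p\<close>.\<close>

lemma sin_moment_0_bounds:
  assumes p: "0 < p"
  shows "0 \<le> sin_moment p 0" "sin_moment p 0 \<le> pi" "p \<le> 3 \<Longrightarrow> 4 / 3 \<le> sin_moment p 0"
proof -
  have i: "set_integrable lborel {0..pi} (\<lambda>r. sin r powr q)" if "0 < q" for q
    using that by (intro sin_powr_integrable) auto
  have c: "set_integrable lborel {0..pi} (\<lambda>r. 1 :: real)"
    by (simp add: set_integrable_def)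
  show "0 \<le> sin_moment p 0"
    by (auto simp: sin_moment_def set_lebesgue_integral_def intro!: integral_nonneg_AE)
  have "sin_moment p 0 \<le> (LBINT r:{0..pi}. 1)"
    unfolding sin_moment_def using p
    by (intro set_integral_mono) (auto intro!: powr_le1 i c simp: sin_ge_zero)
  then show "sin_moment p 0 \<le> pi" by (simp add: set_lebesgue_integral_def)
  assume p3: "p \<le> 3"
  have "sin_moment 3 0 \<le> sin_moment p 0"
    unfolding sin_moment_def using p p3
    by (intro set_integral_mono) (auto intro!: powr_mono' i simp: sin_ge_zero simp del: powr_numeral)
  then show "4 / 3 \<le> sin_moment p 0" by (simp add: sin_moment_3_0)
qed

lemma Mn_eq_Mn_integral: "Mn n p = 2 powr (p - 3) * Mn_integral p n"
  by (simp add: Mn_def Mn_integral_def)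

lemma Mn_0: "Mn 0 p = 0"
  by (simp add: Mn_eq_Mn_integral Mn_integral_0)

lemma Mn_1: "1 < p \<Longrightarrow> Mn 1 p = 0"
  using Mn_integral_1[of p] by (simp add: Mn_eq_Mn_integral)

lemma Mn_nonneg:
  assumes "1 < p" "p < 8"
  shows "0 \<le> Mn n p"
proof (cases n)
  case (Suc k)
  have "0 \<le> 2 * p * sin_moment p 0 * (\<Sum>m<k. increment (p / 2) m)"
    using assms by (intro mult_nonneg_nonneg sin_moment_0_bounds sum_increment_nonneg) auto
  then show ?thesis
    using assms by (simp add: Suc Mn_eq_Mn_integral Mn_integral_eq_sum_increment)
qed (simp add: Mn_0)

text \<open>These are the bounds of \<open>sum_increment_bounds\<close> with the factors \<open>2\<^sup>p\<^sup>-\<^sup>3\<close> and \<open>2p \<integral> sin\<^sup>p\<close>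
  multiplied in.\<close>

definition Mn_lower_const :: "real \<Rightarrow> real" where
  "Mn_lower_const p = 2 powr (p - 3) * sin_moment p 0 * (2 / (p + 2))"

definition Mn_upper_const :: "real \<Rightarrow> real" where
  "Mn_upper_const p = 2 powr (p - 3) * sin_moment p 0 * (16 * 2 powr p / ((p + 2) * (3 - p)))"

lemma Mn_bounds:
  assumes p: "1 < p" "p < 3" and n: "2 \<le> n"
  shows "Mn_lower_const p * real n powr (3 - p) \<le> Mn n p"
    and "Mn n p \<le> Mn_upper_const p * real n powr (3 - p)"
proof -
  obtain k where k: "n = Suc k" "1 \<le> k" using n by (cases n) auto
  define a where "a = p / 2"
  have a: "1/2 < a" "a < 3/2" "p = 2 * a" using p by (simp_all add: a_def)
  define V where "V = 1 / (a * (a + 1))"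
  define C where "C = 2 powr (p - 3) * (2 * p * sin_moment p 0)"
  have C: "0 \<le> C"
    unfolding C_def using p by (intro mult_nonneg_nonneg sin_moment_0_bounds) auto
  have Mn: "Mn n p = C * (\<Sum>m<k. increment a m)"
    using p by (simp add: k Mn_eq_Mn_integral Mn_integral_eq_sum_increment C_def a_def)
  have "2 * p * V = 4 / (a + 1)" using a by (simp add: V_def)
  also have "\<dots> = 8 / (p + 2)" using a by (simp add: field_simps)
  finally have CV: "C * V = 2 powr (p - 3) * sin_moment p 0 * (8 / (p + 2))"
    unfolding C_def by (metis mult.assoc mult.commute)
  have "Mn_lower_const p = C * V / 4"
    unfolding CV using p by (simp add: Mn_lower_const_def field_simps)
  then have lc: "Mn_lower_const p = C * (V / 4)" by simp
  have "Mn_upper_const p = C * V * (2 powr p * (2 / (3 - p)))"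
    unfolding CV by (simp add: Mn_upper_const_def)
  then have uc: "Mn_upper_const p = C * (V * 2 powr (2 * a) * (2 / (3 - 2 * a)))"
    using a by (simp add: mult.assoc)
  have e: "3 - p = 3 - 2 * a" using a by simp
  show "Mn_lower_const p * real n powr (3 - p) \<le> Mn n p"
    using mult_left_mono[OF sum_increment_bounds(1)[OF a(1,2) k(2)] C]
    unfolding Mn lc by (simp only: V_def k(1) e mult.assoc)
  show "Mn n p \<le> Mn_upper_const p * real n powr (3 - p)"
    using mult_left_mono[OF sum_increment_bounds(2)[OF a(1,2) k(2)] C]
    unfolding Mn uc by (simp only: V_def k(1) e mult.assoc)
qed

lemma Mn_const_pos_le:
  assumes p: "1 < p" "p < 3"
  shows "0 < Mn_lower_const p" "Mn_lower_const p \<le> Mn_upper_const p"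
proof -
  have s: "0 < sin_moment p 0" using sin_moment_0_bounds(3)[of p] p by simp
  show pos: "0 < Mn_lower_const p" using s p by (simp add: Mn_lower_const_def)
  have "Mn_lower_const p * 2 powr (3 - p) \<le> Mn_upper_const p * 2 powr (3 - p)"
    using order_trans[OF Mn_bounds[OF p, of 2]] by simp
  then show "Mn_lower_const p \<le> Mn_upper_const p"
    by (rule mult_right_le_imp_le) simp
qed

lemma Mn_const_uniform:
  assumes \<delta>: "0 < \<delta>" and p: "1 + \<delta> \<le> p" "p \<le> 3 - \<delta>"
  shows "2 / 15 \<le> Mn_lower_const p" "Mn_upper_const p \<le> 48 * pi / \<delta>"
proof -
  have "(1/4) * (4/3) * (2/5) \<le> 2 powr (p - 3) * sin_moment p 0 * (2 / (p + 2))"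
  proof (intro mult_mono)
    have "2 powr (-2 :: real) \<le> 2 powr (p - 3)" using p \<delta> by (intro powr_mono) auto
    then show "1/4 \<le> 2 powr (p - 3)" by (simp add: powr_minus)
    show "4/3 \<le> sin_moment p 0" using p \<delta> by (intro sin_moment_0_bounds) auto
    show "2/5 \<le> 2 / (p + 2)" using p \<delta> by (simp add: field_simps)
  qed (use p \<delta> sin_moment_0_bounds[of p] in auto)
  then show "2 / 15 \<le> Mn_lower_const p" by (simp add: Mn_lower_const_def)
  have "2 powr (p - 3) * sin_moment p 0 * (16 * 2 powr p / ((p + 2) * (3 - p)))
      \<le> 1 * pi * (16 * 8 / (3 * \<delta>))"
  proof (intro mult_mono frac_le)
    show "2 powr (p - 3) \<le> 1" using powr_mono[of "p - 3" 0 2] p \<delta> by simp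
    show "2 powr p \<le> 8" using powr_mono[of p 3 2] p \<delta> by simp
    show "sin_moment p 0 \<le> pi" using p \<delta> by (intro sin_moment_0_bounds) auto
  qed (use p \<delta> sin_moment_0_bounds[of p] in auto)
  also have "\<dots> \<le> 48 * pi / \<delta>" using \<delta> by (simp add: field_simps)
  finally show "Mn_upper_const p \<le> 48 * pi / \<delta>" by (simp add: Mn_upper_const_def)
qed



section \<open>Quadratic forms with a periodic difference kernel\<close>

abbreviation angle_measure :: "real measure" where
  "angle_measure \<equiv> restrict_space lborel {0..<2 * pi}"

lemma finite_measure_angle: "finite_measure angle_measure"
  by standard (simp add: emeasure_restrict_space space_restrict_space)

lemma sets_angle_borel: "f \<in> borel_measurable borel \<Longrightarrow> f \<in> borel_measurable angle_measure"
  by (intro measurable_restrict_space1) simp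

lemma has_bochner_integral_angle_iff:
  fixes f :: "real \<Rightarrow> 'b::{banach, second_countable_topology}"
  shows "has_bochner_integral angle_measure f v \<longleftrightarrow>
    has_bochner_integral lborel (\<lambda>x. indicator {0..<2 * pi} x *\<^sub>R f x) v"
  by (simp add: has_bochner_integral_iff integrable_restrict_space integral_restrict_space)

text \<open>Translation by \<open>c\<close> sends \<open>[0, 2\<pi> - c)\<close> to \<open>[c, 2\<pi>)\<close>, and translation by \<open>c - 2\<pi>\<close>, which the periodic
  function does not distinguish from it, sends \<open>[2\<pi> - c, 2\<pi>)\<close> to \<open>[0, c)\<close>.\<close>

lemma has_bochner_integral_periodic_shift:
  fixes g :: "real \<Rightarrow> 'b::{banach, second_countable_topology}"
  assumes per: "\<And>x. g (x + 2 * pi) = g x" and c: "0 \<le> c" "c \<le> 2 * pi"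
    and g: "has_bochner_integral angle_measure g v"
  shows "has_bochner_integral angle_measure (\<lambda>x. g (x - c)) v"
proof -
  let ?T = "2 * pi"
  define f1 where "f1 = (\<lambda>x. indicator {0..<?T - c} x *\<^sub>R g x)"
  define f2 where "f2 = (\<lambda>x. indicator {?T - c..<?T} x *\<^sub>R g x)"
  have gi: "integrable lborel (\<lambda>x. indicator {0..<?T} x *\<^sub>R g x)"
    and gv: "(\<integral>x. indicator {0..<?T} x *\<^sub>R g x \<partial>lborel) = v"
    using g[unfolded has_bochner_integral_angle_iff] unfolding has_bochner_integral_iff by auto
  have eq: "f1 = (\<lambda>x. indicator {0..<?T - c} x *\<^sub>R indicator {0..<?T} x *\<^sub>R g x)"
      "f2 = (\<lambda>x. indicator {?T - c..<?T} x *\<^sub>R indicator {0..<?T} x *\<^sub>R g x)"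
    using c by (auto simp: f1_def f2_def fun_eq_iff indicator_def)
  have i: "integrable lborel f1" "integrable lborel f2"
    unfolding eq by (intro integrable_mult_indicator gi; simp)+
  have "(\<lambda>x. indicator {0..<?T} x *\<^sub>R g x) = (\<lambda>x. f1 x + f2 x)"
    using c by (auto simp: f1_def f2_def fun_eq_iff indicator_def)
  then have v: "v = integral\<^sup>L lborel f1 + integral\<^sup>L lborel f2"
    using gv i by simp
  have 1: "has_bochner_integral lborel (\<lambda>x. f1 (- c + 1 * x)) (integral\<^sup>L lborel f1 /\<^sub>R \<bar>1\<bar>)"
    using has_bochner_integral_integrable[OF i(1)]
    by (subst lborel_has_bochner_integral_real_affine_iff[symmetric]) auto
  have 2: "has_bochner_integral lborel (\<lambda>x. f2 ((?T - c) + 1 * x)) (integral\<^sup>L lborel f2 /\<^sub>R \<bar>1\<bar>)"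
    using has_bochner_integral_integrable[OF i(2)]
    by (subst lborel_has_bochner_integral_real_affine_iff[symmetric]) auto
  have "(\<lambda>x. indicator {0..<?T} x *\<^sub>R g (x - c)) = (\<lambda>x. f1 (- c + 1 * x) + f2 ((?T - c) + 1 * x))"
  proof
    fix x
    have "g (2 * pi - c + x) = g (x - c)" using per[of "x - c"] by (simp add: algebra_simps)
    then show "indicator {0..<?T} x *\<^sub>R g (x - c) = f1 (- c + 1 * x) + f2 ((?T - c) + 1 * x)"
      using c by (auto simp: f1_def f2_def indicator_def)
  qed
  then show ?thesis
    using has_bochner_integral_add[OF 1 2] by (simp add: has_bochner_integral_angle_iff v)
qed

lemma integral_angle_eq:
  fixes f :: "real \<Rightarrow> 'b::{banach, second_countable_topology}"
  assumes [measurable]: "f \<in> borel_measurable borel"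
  shows "(\<integral>x. f x \<partial>angle_measure) = (LBINT x:{0..2 * pi}. f x)"
proof -
  have "(\<integral>x. f x \<partial>angle_measure) = (LBINT x:{0..<2 * pi}. f x)"
    by (simp add: integral_restrict_space set_lebesgue_integral_def)
  also have "\<dots> = (LBINT x:{0..2 * pi}. f x)"
    unfolding set_lebesgue_integral_def
  proof (rule integral_cong_AE)
    have "AE x in lborel. x \<noteq> 2 * pi" by (rule AE_lborel_singleton)
    then show "AE x in lborel. indicator {0..<2 * pi} x *\<^sub>R f x = indicator {0..2 * pi} x *\<^sub>R f x"
      by eventually_elim (auto simp: indicator_def)
  qed measurable
  finally show ?thesis .
qed

lemma has_bochner_integral_character:
  "has_bochner_integral angle_measure (\<lambda>x. cis (of_int j * x)) (if j = 0 then of_real (2 * pi) else 0)"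
proof -
  have int: "integrable angle_measure (\<lambda>x. cis (of_int j * x))"
    by (rule finite_measure.integrable_const_bound[OF finite_measure_angle, where B = 1])
      (auto intro!: sets_angle_borel borel_measurable_continuous_onI continuous_intros)
  have "(\<integral>x. cis (of_int j * x) \<partial>angle_measure) = (LBINT x:{0..2 * pi}. cis (of_int j * x))"
    by (intro integral_angle_eq borel_measurable_continuous_onI continuous_intros)
  also have "\<dots> = (if j = 0 then of_real (2 * pi) else 0)"
  proof (cases "j = 0")
    case True
    have "(LBINT x:{0..2 * pi}. (1::complex)) = of_real (2 * pi)"
      by (simp add: set_lebesgue_integral_def scaleR_conv_of_real)
    then show ?thesis using True by simp
  next
    case False
    define F where "F = (\<lambda>x. - \<i> / of_int j * cis (of_int j * x))"
    have "(\<integral>x. indicator {0..2 * pi} x *\<^sub>R cis (of_int j * x) \<partial>lborel) = F (2 * pi) - F 0"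
    proof (rule integral_FTC_Icc)
      fix x :: real
      have "((\<lambda>x. cis (of_int j * x)) has_vector_derivative (of_int j) *\<^sub>R (\<i> * cis (of_int j * x))) (at x within {0..2 * pi})"
        unfolding has_vector_derivative_def
        by (auto intro!: derivative_eq_intros simp: fun_eq_iff scaleR_conv_of_real)
      from has_vector_derivative_mult_right[OF this, of "- \<i> / of_int j"]
      show "(F has_vector_derivative cis (of_int j * x)) (at x within {0..2 * pi})"
        unfolding F_def using False by (simp add: scaleR_conv_of_real)
    qed (auto intro!: continuous_intros)
    moreover have "cis (of_int j * (2 * pi)) = 1"
      using cis_multiple_2pi[of "of_int j"] by (simp add: mult_ac)
    ultimately show ?thesis using False by (simp add: F_def set_lebesgue_integral_def)
  qed
  finally show ?thesis using int by (simp add: has_bochner_integral_iff)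
qed

text \<open>Substituting \<open>y = x + h\<close> separates the variables in each summand: the dependence on \<open>x\<close> is a single
  character and the dependence on \<open>h\<close> goes into the coupling coefficients below.\<close>

lemma norm_sum_sq_expand:
  fixes c :: "int \<Rightarrow> complex"
  shows "complex_of_real ((norm ((\<Sum>n\<in>S. c n * cis (of_int n * x)) - (\<Sum>n\<in>S. c n * cis (of_int n * y))))\<^sup>2) =
    (\<Sum>m\<in>S. \<Sum>n\<in>S. c m * cnj (c n) * cis (of_int (m - n) * x) *
      ((1 - cis (of_int m * (y - x))) * (1 - cis (- of_int n * (y - x)))))"
proof -
  have 1: "c n * cis (of_int n * x) - c n * cis (of_int n * y) =
     c n * cis (of_int n * x) * (1 - cis (of_int n * (y - x)))" for n
    by (simp add: algebra_simps cis_mult)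
  have 2: "c m * cis (of_int m * x) * (1 - cis (of_int m * (y - x))) *
        cnj (c n * cis (of_int n * x) * (1 - cis (of_int n * (y - x)))) =
      c m * cnj (c n) * cis (of_int (m - n) * x) *
      ((1 - cis (of_int m * (y - x))) * (1 - cis (- of_int n * (y - x))))" for m n
  proof -
    have "cis (of_int (m - n) * x) = cis (of_int m * x) * cis (- (of_int n * x))"
      by (simp add: cis_mult algebra_simps)
    then show ?thesis by (simp add: cis_cnj mult_ac)
  qed
  show ?thesis
    unfolding complex_norm_square sum_subtractf[symmetric] 1 cnj_sum sum_product 2 by simp
qed

text \<open>The kernel itself may be too singular to be integrable. Each factor \<open>1 - e\<^sup>i\<^sup>m\<^sup>h\<close> vanishes at \<open>h = 0\<close>
  and only the product with two of them has to be integrable.\<close>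

locale periodic_kernel =
  fixes k :: "real \<Rightarrow> real"
  assumes k_measurable: "k \<in> borel_measurable borel"
    and k_periodic: "k (h + 2 * pi) = k h"
    and k_integrable: "integrable angle_measure
      (\<lambda>h. k h *\<^sub>R ((1 - cis (of_int m * h)) * (1 - cis (- of_int n * h))))"
begin

definition coupling :: "int \<Rightarrow> int \<Rightarrow> complex" where
  "coupling m n = (\<integral>h. k h *\<^sub>R ((1 - cis (of_int m * h)) * (1 - cis (- of_int n * h))) \<partial>angle_measure)"

text \<open>By periodicity the integration over \<open>y\<close> may be replaced by one over \<open>h = y - x\<close> on the same period.\<close>

lemma inner_integral:
  assumes x: "0 \<le> x" "x \<le> 2 * pi"
  shows "has_bochner_integral angle_measure
    (\<lambda>y. complex_of_real (k (y - x) *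
      (norm ((\<Sum>n\<in>S. c n * cis (of_int n * x)) - (\<Sum>n\<in>S. c n * cis (of_int n * y))))\<^sup>2))
    (\<Sum>m\<in>S. \<Sum>n\<in>S. c m * cnj (c n) * cis (of_int (m - n) * x) * coupling m n)"
proof -
  define g where "g = (\<lambda>h. \<Sum>m\<in>S. \<Sum>n\<in>S. c m * cnj (c n) * cis (of_int (m - n) * x) *
      (k h *\<^sub>R ((1 - cis (of_int m * h)) * (1 - cis (- of_int n * h)))))"
  have per: "cis (of_int m * (h + 2 * pi)) = cis (of_int m * h)" for m :: int and h
    using cis_multiple_2pi[of "of_int m"] by (simp add: distrib_left cis_mult[symmetric] mult_ac)
  have per': "cis (- of_int m * (h + 2 * pi)) = cis (- of_int m * h)" for m :: int and h
    using per[of "- m" h] by simp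
  have "has_bochner_integral angle_measure g
     (\<Sum>m\<in>S. \<Sum>n\<in>S. c m * cnj (c n) * cis (of_int (m - n) * x) * coupling m n)"
    unfolding g_def coupling_def
    by (intro has_bochner_integral_sum has_bochner_integral_mult_right
        has_bochner_integral_integrable k_integrable)
  then have "has_bochner_integral angle_measure (\<lambda>y. g (y - x))
     (\<Sum>m\<in>S. \<Sum>n\<in>S. c m * cnj (c n) * cis (of_int (m - n) * x) * coupling m n)"
    by (intro has_bochner_integral_periodic_shift x) (simp_all only: g_def per per' k_periodic)
  moreover have "g (y - x) = complex_of_real (k (y - x) *
      (norm ((\<Sum>n\<in>S. c n * cis (of_int n * x)) - (\<Sum>n\<in>S. c n * cis (of_int n * y))))\<^sup>2)" for y
    unfolding of_real_mult norm_sum_sq_expand g_def sum_distrib_left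
    by (simp add: scaleR_conv_of_real mult_ac)
  ultimately show ?thesis by simp
qed

text \<open>Orthogonality of the characters leaves the diagonal.\<close>

lemma outer_integral:
  assumes S: "finite S"
  shows "has_bochner_integral angle_measure
    (\<lambda>x. \<Sum>m\<in>S. \<Sum>n\<in>S. c m * cnj (c n) * cis (of_int (m - n) * x) * coupling m n)
    (2 * pi * (\<Sum>n\<in>S. (norm (c n))\<^sup>2 * coupling n n))"
proof -
  have "has_bochner_integral angle_measure
    (\<lambda>x. \<Sum>m\<in>S. \<Sum>n\<in>S. c m * cnj (c n) * cis (of_int (m - n) * x) * coupling m n)
    (\<Sum>m\<in>S. \<Sum>n\<in>S. c m * cnj (c n) * (if m - n = 0 then of_real (2 * pi) else 0) * coupling m n)"
    by (intro has_bochner_integral_sum has_bochner_integral_mult_right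
        has_bochner_integral_mult_left has_bochner_integral_character)
  also have "(\<Sum>m\<in>S. \<Sum>n\<in>S. c m * cnj (c n) * (if m - n = 0 then of_real (2 * pi) else 0) * coupling m n)
     = (\<Sum>m\<in>S. \<Sum>n\<in>S. if m = n then of_real (2 * pi) * (of_real ((norm (c m))\<^sup>2) * coupling m m) else 0)"
    by (intro sum.cong refl) (auto simp: complex_norm_square[symmetric] simp del: of_real_power)
  also have "\<dots> = 2 * pi * (\<Sum>n\<in>S. (norm (c n))\<^sup>2 * coupling n n)"
    using S by (simp add: sum.delta sum_distrib_left)
  finally show ?thesis .
qed

text \<open>This allows the absolute integrability that Fubini's theorem asks for to be read off from the same
  computation with the kernel \<open>\<bar>k\<bar>\<close>.\<close>

lemma abs_kernel: "periodic_kernel (\<lambda>h. \<bar>k h\<bar>)"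
proof
  fix m n :: int
  have m: "(\<lambda>h. \<bar>k h\<bar> *\<^sub>R ((1 - cis (of_int m * h)) * (1 - cis (- of_int n * h)))) \<in> borel_measurable borel"
    by (intro borel_measurable_scaleR borel_measurable_abs k_measurable
        borel_measurable_continuous_onI[of "\<lambda>h. (1 - cis (of_int m * h)) * (1 - cis (- of_int n * h))"]
        continuous_intros)
  show "integrable angle_measure (\<lambda>h. \<bar>k h\<bar> *\<^sub>R ((1 - cis (of_int m * h)) * (1 - cis (- of_int n * h))))"
    by (rule Bochner_Integration.integrable_bound[OF k_integrable[of m n]])
      (use sets_angle_borel[OF m] in auto)
qed (auto simp: k_periodic intro: borel_measurable_abs k_measurable)

text \<open>Only the integration order \<open>y\<close>, then \<open>x\<close> is computed: the inner integral is a trigonometric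
  polynomial in \<open>x\<close>, so the outer one needs no further convergence argument.\<close>

theorem double_integral:
  fixes c :: "int \<Rightarrow> complex"
  assumes S: "finite S"
  defines "f \<equiv> \<lambda>x. \<Sum>n\<in>S. c n * cis (of_int n * x)"
  shows "integrable (angle_measure \<Otimes>\<^sub>M angle_measure) (\<lambda>(x, y). k (y - x) * (norm (f x - f y))\<^sup>2)"
    and "(\<integral>(x, y). k (y - x) * (norm (f x - f y))\<^sup>2 \<partial>(angle_measure \<Otimes>\<^sub>M angle_measure)) =
      2 * pi * (\<Sum>n\<in>S. (norm (c n))\<^sup>2 * Re (coupling n n))"
proof -
  interpret A: finite_measure angle_measure by (rule finite_measure_angle)
  interpret AA: pair_sigma_finite angle_measure angle_measure by standard
  interpret abs: periodic_kernel "\<lambda>h. \<bar>k h\<bar>" by (rule abs_kernel)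
  define H where "H = (\<lambda>(x, y). k (y - x) * (norm (f x - f y))\<^sup>2)"
  have fc: "f \<in> borel_measurable borel"
    unfolding f_def by (intro borel_measurable_continuous_onI continuous_intros)
  have id: "(\<lambda>x. x) \<in> borel_measurable angle_measure" by (intro sets_angle_borel) simp
  have H_meas: "H \<in> borel_measurable (angle_measure \<Otimes>\<^sub>M angle_measure)"
  proof -
    have xm: "fst \<in> borel_measurable (angle_measure \<Otimes>\<^sub>M angle_measure)"
      "snd \<in> borel_measurable (angle_measure \<Otimes>\<^sub>M angle_measure)"
      using measurable_compose[OF measurable_fst id] measurable_compose[OF measurable_snd id] by auto
    note [measurable] = xm k_measurable fc
    show ?thesis unfolding H_def split_beta by measurable
  qed
  define W where "W = (\<lambda>x. \<Sum>m\<in>S. \<Sum>n\<in>S. c m * cnj (c n) * cis (of_int (m - n) * x) * coupling m n)"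
  have inner: "has_bochner_integral angle_measure (\<lambda>y. H (x, y)) (Re (W x))"
    if "x \<in> space angle_measure" for x
    using has_bochner_integral_Re[OF inner_integral[of x c S]] that
    by (simp add: H_def W_def f_def space_restrict_space)
  have inner_abs: "has_bochner_integral angle_measure (\<lambda>y. norm (H (x, y)))
     (Re (\<Sum>m\<in>S. \<Sum>n\<in>S. c m * cnj (c n) * cis (of_int (m - n) * x) * abs.coupling m n))"
    if "x \<in> space angle_measure" for x
    using has_bochner_integral_Re[OF abs.inner_integral[of x c S]] that
    by (simp add: H_def f_def space_restrict_space abs_mult)
  have int: "integrable (angle_measure \<Otimes>\<^sub>M angle_measure) H"
  proof (rule AA.Fubini_integrable[OF H_meas])
    have "integrable angle_measure (\<lambda>x. Re (\<Sum>m\<in>S. \<Sum>n\<in>S. c m * cnj (c n) *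
        cis (of_int (m - n) * x) * abs.coupling m n))"
      using abs.outer_integral[OF S, of c] by (intro integrable_Re) (simp add: has_bochner_integral_iff)
    then show "integrable angle_measure (\<lambda>x. \<integral>y. norm (H (x, y)) \<partial>angle_measure)"
      using inner_abs
      by (subst Bochner_Integration.integrable_cong[OF refl]) (auto simp: has_bochner_integral_iff)
    show "AE x in angle_measure. integrable angle_measure (\<lambda>y. H (x, y))"
      using inner by (intro AE_I2) (auto simp: has_bochner_integral_iff)
  qed
  have "integral\<^sup>L (angle_measure \<Otimes>\<^sub>M angle_measure) H =
     (\<integral>x. (\<integral>y. H (x, y) \<partial>angle_measure) \<partial>angle_measure)"
    using AA.integral_fst'[OF int] by simp
  also have "\<dots> = (\<integral>x. Re (W x) \<partial>angle_measure)"
    using inner by (intro Bochner_Integration.integral_cong) (auto simp: has_bochner_integral_iff)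
  also have "\<dots> = Re (2 * pi * (\<Sum>n\<in>S. (norm (c n))\<^sup>2 * coupling n n))"
    using has_bochner_integral_Re[OF outer_integral[OF S, of c]]
    unfolding W_def by (simp add: has_bochner_integral_iff)
  also have "\<dots> = 2 * pi * (\<Sum>n\<in>S. (norm (c n))\<^sup>2 * Re (coupling n n))"
    by simp
  finally show "(\<integral>(x, y). k (y - x) * (norm (f x - f y))\<^sup>2 \<partial>(angle_measure \<Otimes>\<^sub>M angle_measure)) =
      2 * pi * (\<Sum>n\<in>S. (norm (c n))\<^sup>2 * Re (coupling n n))"
    unfolding H_def .
  show "integrable (angle_measure \<Otimes>\<^sub>M angle_measure) (\<lambda>(x, y). k (y - x) * (norm (f x - f y))\<^sup>2)"
    using int unfolding H_def .
qed

end



section \<open>Diagonalization of the form\<close>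

text \<open>In the angle \<open>h\<close> between \<open>x\<close> and \<open>y\<close> one has \<open>|x - y| = 2 |sin (h/2)|\<close>, \<open>\<langle>x, y\<rangle> = cos h\<close> and
  \<open>\<langle>x, i y\<rangle>\<^sup>2 = sin\<^sup>2 h\<close>, and the kernel of the form becomes this function of \<open>h\<close>.\<close>

definition circle_kernel :: "real \<Rightarrow> real \<Rightarrow> real" where
  "circle_kernel p h = \<bar>2 * sin (h / 2)\<bar> powr (p - 4) * (p * (cos (h / 2))\<^sup>2 - 1)"

lemma norm_one_minus_cis: "norm (1 - cis t) = \<bar>2 * sin (t / 2)\<bar>"
  using dist_exp_i_1[of t] by (simp add: cis_conv_exp norm_minus_commute abs_mult)

lemma norm_one_minus_cis_int_le:
  "norm (1 - cis (of_int m * h)) \<le> \<bar>of_int m\<bar> * \<bar>2 * sin (h / 2)\<bar>"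
proof -
  have "\<bar>sin (of_int m * (h / 2))\<bar> = \<bar>sin (real (nat \<bar>m\<bar>) * (h / 2))\<bar>"
    by (cases "0 \<le> m") auto
  also have "\<dots> \<le> \<bar>of_int m\<bar> * \<bar>sin (h / 2)\<bar>"
    using abs_sin_nat_mult_le[of "nat \<bar>m\<bar>" "h / 2"] by simp
  finally show ?thesis by (simp add: norm_one_minus_cis abs_mult)
qed

lemma half_angle_powr_integrable:
  assumes "-1 < q"
  shows "integrable angle_measure (\<lambda>h. \<bar>2 * sin (h / 2)\<bar> powr q)"
proof -
  have "integrable lborel (\<lambda>r. indicator {0..pi} r *\<^sub>R sin r powr q)"
    using sin_powr_integrable[OF assms] by (simp add: set_integrable_def)
  from lborel_integrable_real_affine[OF this, of "1/2" 0]
  have "integrable lborel (\<lambda>h. indicator {0..pi} (h / 2) *\<^sub>R sin (h / 2) powr q)" by simp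
  then have "integrable lborel (\<lambda>h. 2 powr q * (indicator {0..<2 * pi} h *\<^sub>R
      indicator {0..pi} (h / 2) *\<^sub>R sin (h / 2) powr q))"
    by (intro integrable_mult_right integrable_mult_indicator) auto
  also have "(\<lambda>h. 2 powr q * (indicator {0..<2 * pi} h *\<^sub>R
      indicator {0..pi} (h / 2) *\<^sub>R sin (h / 2) powr q)) =
      (\<lambda>h. indicator {0..<2 * pi} h *\<^sub>R \<bar>2 * sin (h / 2)\<bar> powr q)"
    by (auto simp: fun_eq_iff indicator_def abs_mult powr_mult sin_ge_zero)
  finally show ?thesis by (simp add: integrable_restrict_space)
qed

text \<open>Two factors \<open>|1 - e\<^sup>i\<^sup>m\<^sup>h| \<le> |m| |2 sin (h/2)|\<close> raise the exponent \<open>p - 4\<close> of the kernel to \<open>p - 2 > -1\<close>.\<close>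

lemma circle_kernel_periodic_kernel:
  assumes p: "1 < p"
  shows "periodic_kernel (circle_kernel p)"
proof
  show km: "circle_kernel p \<in> borel_measurable borel"
    unfolding circle_kernel_def[abs_def] by measurable
  show "circle_kernel p (h + 2 * pi) = circle_kernel p h" for h
    by (simp add: circle_kernel_def add_divide_distrib)
  fix m n :: int
  define C where "C = (p + 1) * (\<bar>of_int m\<bar> * \<bar>of_int n\<bar> :: real)"
  have i: "integrable angle_measure (\<lambda>h. C * \<bar>2 * sin (h / 2)\<bar> powr (p - 2))"
    using p by (intro integrable_mult_right half_angle_powr_integrable) auto
  have m: "(\<lambda>h. circle_kernel p h *\<^sub>R ((1 - cis (of_int m * h)) * (1 - cis (- of_int n * h)))) \<in>
      borel_measurable borel"
    by (intro borel_measurable_scaleR km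
        borel_measurable_continuous_onI[of "\<lambda>h. (1 - cis (of_int m * h)) * (1 - cis (- of_int n * h))"]
        continuous_intros)
  have bound: "norm (circle_kernel p h *\<^sub>R ((1 - cis (of_int m * h)) * (1 - cis (- of_int n * h)))) \<le>
      norm (C * \<bar>2 * sin (h / 2)\<bar> powr (p - 2))" for h
  proof -
    define d where "d = \<bar>2 * sin (h / 2)\<bar>"
    have d: "0 \<le> d" by (simp add: d_def)
    have "\<bar>p * (cos (h / 2))\<^sup>2 - 1\<bar> \<le> p * (cos (h / 2))\<^sup>2 + 1"
      using p by (simp add: abs_le_iff)
    also have "\<dots> \<le> p * 1 + 1"
      using p by (intro add_mono mult_left_mono) (auto simp: abs_square_le_1)
    finally have k: "\<bar>circle_kernel p h\<bar> \<le> d powr (p - 4) * (p + 1)"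
      by (simp add: circle_kernel_def abs_mult d_def mult_left_mono)
    have "norm (circle_kernel p h *\<^sub>R ((1 - cis (of_int m * h)) * (1 - cis (- of_int n * h))))
       = \<bar>circle_kernel p h\<bar> * (norm (1 - cis (of_int m * h)) * norm (1 - cis (of_int (- n) * h)))"
      by (simp add: norm_mult)
    also have "\<dots> \<le> (d powr (p - 4) * (p + 1)) * ((\<bar>of_int m\<bar> * d) * (\<bar>of_int (- n)\<bar> * d))"
      using d p unfolding d_def by (intro mult_mono norm_one_minus_cis_int_le k[unfolded d_def]) auto
    also have "\<dots> = C * (d powr (p - 4) * d\<^sup>2)"
      by (simp add: C_def power2_eq_square)
    also have "d powr (p - 4) * d\<^sup>2 = d powr (p - 2)"
    proof (cases "d = 0")
      case False
      then have "d powr (p - 4) * d powr 2 = d powr (p - 4 + 2)" by (simp only: powr_add)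
      then show ?thesis using d False by simp
    qed simp
    finally show ?thesis using p by (simp add: d_def C_def)
  qed
  show "integrable angle_measure
      (\<lambda>h. circle_kernel p h *\<^sub>R ((1 - cis (of_int m * h)) * (1 - cis (- of_int n * h))))"
    by (rule Bochner_Integration.integrable_bound[OF i])
      (use sets_angle_borel[OF m] bound in auto)
qed

text \<open>The substitution \<open>h = 2r\<close> turns the diagonal coupling coefficient into the integral that defines
  the multiplier.\<close>

lemma Re_coupling_circle_kernel:
  assumes p: "1 < p"
  shows "Re (periodic_kernel.coupling (circle_kernel p) n n) = 2 * Mn (nat \<bar>n\<bar>) p"
proof -
  interpret periodic_kernel "circle_kernel p" by (rule circle_kernel_periodic_kernel[OF p])
  define N where "N = nat \<bar>n\<bar>"
  have cosN: "cos (of_int n * h) = cos (real N * h)" for h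
    by (cases "0 \<le> n") (auto simp: N_def)
  have "Re (coupling n n) = (\<integral>h. Re (circle_kernel p h *\<^sub>R
      ((1 - cis (of_int n * h)) * (1 - cis (- of_int n * h)))) \<partial>angle_measure)"
    unfolding coupling_def by (rule integral_Re[symmetric]) (rule k_integrable)
  also have "\<dots> = (\<integral>h. circle_kernel p h * (2 - 2 * cos (real N * h)) \<partial>angle_measure)"
  proof (intro Bochner_Integration.integral_cong refl)
    fix h
    have "Re ((1 - cis (of_int n * h)) * (1 - cis (- of_int n * h))) = 2 - 2 * cos (of_int n * h)"
      using sin_cos_squared_add[of "of_int n * h"]
      by (simp add: power2_eq_square algebra_simps)
    then show "Re (circle_kernel p h *\<^sub>R ((1 - cis (of_int n * h)) * (1 - cis (- of_int n * h)))) =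
        circle_kernel p h * (2 - 2 * cos (real N * h))"
      by (simp add: cosN)
  qed
  also have "\<dots> = (\<integral>h. indicator {0..<2 * pi} h *\<^sub>R (circle_kernel p h * (2 - 2 * cos (real N * h))) \<partial>lborel)"
    by (simp add: integral_restrict_space)
  also have "\<dots> = 2 * (\<integral>r. indicator {0..<2 * pi} (2 * r) *\<^sub>R
      (circle_kernel p (2 * r) * (2 - 2 * cos (real N * (2 * r)))) \<partial>lborel)"
    by (subst lborel_integral_real_affine[of 2 _ 0]) auto
  also have "(\<lambda>r. indicator {0..<2 * pi} (2 * r) *\<^sub>R
      (circle_kernel p (2 * r) * (2 - 2 * cos (real N * (2 * r))))) =
      (\<lambda>r. (2 * 2 powr (p - 4)) * (indicator {0..pi} r *\<^sub>R Mn_integrand N p r))"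
  proof
    fix r :: real
    consider "r \<in> {0..<pi}" | "r = pi" | "r \<notin> {0..pi}" by force
    then show "indicator {0..<2 * pi} (2 * r) *\<^sub>R
      (circle_kernel p (2 * r) * (2 - 2 * cos (real N * (2 * r)))) =
      (2 * 2 powr (p - 4)) * (indicator {0..pi} r *\<^sub>R Mn_integrand N p r)"
    proof cases
      case 1
      then show ?thesis
        by (simp add: circle_kernel_def Mn_integrand_def abs_mult powr_mult sin_ge_zero algebra_simps)
    qed (auto simp: Mn_integrand_def indicator_def)
  qed
  also have "2 * (\<integral>r. (2 * 2 powr (p - 4)) * (indicator {0..pi} r *\<^sub>R Mn_integrand N p r) \<partial>lborel) =
      2 * ((2 * 2 powr (p - 4)) * (LBINT r:{0..pi}. Mn_integrand N p r))"
    unfolding set_lebesgue_integral_def by simp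
  also have "2 * 2 powr (p - 4) = 2 powr (1 + (p - 4))"
    by (simp only: powr_add) simp
  also have "1 + (p - 4) = p - 3" by simp
  finally show ?thesis by (simp add: Mn_def N_def)
qed

lemma Qp_integrand_cis:
  "Qp_integrand p \<eta> (cis x) (cis y) = circle_kernel p (y - x) * (\<eta> (cis x) - \<eta> (cis y))\<^sup>2"
proof -
  define d where "d = \<bar>2 * sin ((y - x) / 2)\<bar>"
  have "cis x - cis y = cis x * (1 - cis (y - x))" by (simp add: algebra_simps cis_mult)
  then have norm: "norm (cis x - cis y) = d"
    by (simp only: norm_mult norm_cis norm_one_minus_cis d_def mult_1_left)
  define t where "t = (y - x) / 2"
  have yx: "y - x = 2 * t" by (simp add: t_def)
  have inner1: "cis x \<bullet> cis y = 2 * (cos t)\<^sup>2 - 1"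
    using cos_diff[of y x] cos_double_cos[of t] by (simp add: inner_complex_def yx mult.commute)
  have inner2: "cis x \<bullet> (\<i> * cis y) = - (2 * sin t * cos t)"
    using sin_diff[of y x] by (simp add: inner_complex_def yx sin_double)
  show ?thesis
  proof (cases "d = 0")
    case True
    then have "cis x = cis y" using norm by simp
    then show ?thesis by (simp add: Qp_integrand_def)
  next
    case False
    then have d: "0 < d" by (simp add: d_def)
    have d2: "d powr (p - 2) = d powr (p - 4) * d\<^sup>2"
      using d powr_add[of d "p - 4" 2] by simp
    have s: "4 * (sin t)\<^sup>2 = d\<^sup>2" by (simp add: d_def t_def power_mult_distrib)
    have "\<bar>- (2 * sin t * cos t)\<bar>\<^sup>2 = 4 * (sin t)\<^sup>2 * (cos t)\<^sup>2"
      by (simp add: power_mult_distrib)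
    then have in2: "\<bar>cis x \<bullet> (\<i> * cis y)\<bar>\<^sup>2 = d\<^sup>2 * (cos t)\<^sup>2" unfolding inner2 s .
    have "Qp_integrand p \<eta> (cis x) (cis y) =
       ((p - 2) * (d\<^sup>2 * (cos t)\<^sup>2) * d powr (p - 4) + d powr (p - 4) * d\<^sup>2 * (2 * (cos t)\<^sup>2 - 1)) *
         (\<eta> (cis x) - \<eta> (cis y))\<^sup>2 / d\<^sup>2"
      by (simp only: Qp_integrand_def norm inner1 d2 power2_abs in2[unfolded power2_abs])
    also have "\<dots> = d powr (p - 4) * (p * (cos t)\<^sup>2 - 1) * (\<eta> (cis x) - \<eta> (cis y))\<^sup>2"
      using d by (simp add: field_simps)
    finally show ?thesis by (simp add: circle_kernel_def d_def t_def)
  qed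
qed

lemma exp_i_eq_cis: "exp (\<i> * of_real \<theta>) = cis \<theta>"
  by (simp add: cis_conv_exp)

lemma exp_i_int_eq_cis: "exp (\<i> * of_int n * of_real \<theta>) = cis (of_int n * \<theta>)"
  by (simp add: cis_conv_exp mult.assoc)

lemma trig_poly_cis:
  assumes "trig_poly \<eta> c"
  shows "complex_of_real (\<eta> (cis \<theta>)) = (\<Sum>n | c n \<noteq> 0. c n * cis (of_int n * \<theta>))"
  using assms unfolding trig_poly_def exp_i_eq_cis exp_i_int_eq_cis by blast

text \<open>On the circle the trigonometric polynomial is a Laurent polynomial in \<open>z\<close>, hence continuous.\<close>

lemma trig_poly_measurable:
  assumes "trig_poly \<eta> c"
  shows "\<eta> \<in> borel_measurable (restrict_space borel (sphere 0 1))"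
proof -
  have "continuous_on (sphere 0 1) (\<lambda>z. Re (\<Sum>n | c n \<noteq> 0. c n * z powi n))"
    by (intro continuous_intros) auto
  moreover have "Re (\<Sum>n | c n \<noteq> 0. c n * z powi n) = \<eta> z" if "z \<in> sphere 0 1" for z
  proof -
    have "z = cis (Arg z)" using that cis_Arg[of z] by (cases "z = 0") (auto simp: sgn_div_norm)
    then obtain \<theta> where \<theta>: "z = cis \<theta>" by blast
    have "(\<Sum>n | c n \<noteq> 0. c n * z powi n) = complex_of_real (\<eta> z)"
      unfolding \<theta> trig_poly_cis[OF assms] by (simp add: cis_power_int)
    then show ?thesis by simp
  qed
  ultimately have "continuous_on (sphere 0 1) \<eta>"
    by (subst continuous_on_cong[OF refl]) auto
  then show ?thesis by (rule borel_measurable_continuous_on_restrict)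
qed

lemma circle_measure_pair:
  "circle_measure \<Otimes>\<^sub>M circle_measure = distr (angle_measure \<Otimes>\<^sub>M angle_measure)
     (restrict_space borel (sphere 0 1) \<Otimes>\<^sub>M restrict_space borel (sphere 0 1)) (\<lambda>(x, y). (cis x, cis y))"
proof -
  have "finite_measure circle_measure"
    by (rule finite_measureI) (simp add: space_circle_measure emeasure_circle_measure)
  then have "sigma_finite_measure circle_measure"
    by (rule finite_measure.axioms(1))
  then show ?thesis
    unfolding circle_measure_def by (intro pair_measure_distr cis_measurable_circle)
qed

lemma Qp_integrand_measurable:
  assumes "\<eta> \<in> borel_measurable (restrict_space borel (sphere 0 1))"
  shows "(\<lambda>z. Qp_integrand p \<eta> (fst z) (snd z)) \<in>
    borel_measurable (restrict_space borel (sphere 0 1) \<Otimes>\<^sub>M restrict_space borel (sphere 0 1))"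
proof -
  let ?B = "restrict_space borel (sphere (0::complex) 1)"
  have id: "(\<lambda>x. x) \<in> borel_measurable ?B" by (intro measurable_restrict_space1) simp
  have [measurable]: "fst \<in> borel_measurable (?B \<Otimes>\<^sub>M ?B)" "snd \<in> borel_measurable (?B \<Otimes>\<^sub>M ?B)"
    using measurable_compose[OF measurable_fst id] measurable_compose[OF measurable_snd id] by auto
  have [measurable]: "(\<lambda>z. \<eta> (fst z)) \<in> borel_measurable (?B \<Otimes>\<^sub>M ?B)"
      "(\<lambda>z. \<eta> (snd z)) \<in> borel_measurable (?B \<Otimes>\<^sub>M ?B)"
    using measurable_compose[OF measurable_fst assms] measurable_compose[OF measurable_snd assms] by auto
  show ?thesis unfolding Qp_integrand_def by measurable
qed

theorem Qp_trig_poly: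
  assumes p: "1 < p" and \<eta>: "trig_poly \<eta> c"
  shows "integrable (circle_measure \<Otimes>\<^sub>M circle_measure) (\<lambda>z. Qp_integrand p \<eta> (fst z) (snd z))"
    and "Qp p \<eta> = 4 * pi * (\<Sum>n | c n \<noteq> 0. Mn (nat \<bar>n\<bar>) p * (norm (c n))\<^sup>2)"
proof -
  interpret periodic_kernel "circle_kernel p" by (rule circle_kernel_periodic_kernel[OF p])
  have S: "finite {n. c n \<noteq> 0}" using \<eta> by (simp add: trig_poly_def)
  let ?f = "\<lambda>x. \<Sum>n | c n \<noteq> 0. c n * cis (of_int n * x)"
  have eq: "(\<lambda>(x, y). circle_kernel p (y - x) * (norm (?f x - ?f y))\<^sup>2) =
     (\<lambda>z. Qp_integrand p \<eta> (fst (case z of (x, y) \<Rightarrow> (cis x, cis y))) (snd (case z of (x, y) \<Rightarrow> (cis x, cis y))))"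
    by (auto simp: fun_eq_iff Qp_integrand_cis trig_poly_cis[OF \<eta>, symmetric] of_real_diff[symmetric]
        simp del: of_real_diff)
  have cm: "(\<lambda>(x, y). (cis x, cis y)) \<in> angle_measure \<Otimes>\<^sub>M angle_measure \<rightarrow>\<^sub>M
      restrict_space borel (sphere 0 1) \<Otimes>\<^sub>M restrict_space borel (sphere 0 1)"
    using cis_measurable_circle by measurable
  note Qm = Qp_integrand_measurable[OF trig_poly_measurable[OF \<eta>], of p]
  show "integrable (circle_measure \<Otimes>\<^sub>M circle_measure) (\<lambda>z. Qp_integrand p \<eta> (fst z) (snd z))"
    unfolding circle_measure_pair integrable_distr_eq[OF cm Qm] eq[symmetric]
    by (rule double_integral[OF S])
  have "Qp p \<eta> = 2 * pi * (\<Sum>n | c n \<noteq> 0. (norm (c n))\<^sup>2 * Re (coupling n n))"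
    unfolding Qp_def circle_measure_pair integral_distr[OF cm Qm] eq[symmetric]
    by (rule double_integral[OF S])
  also have "\<dots> = 4 * pi * (\<Sum>n | c n \<noteq> 0. Mn (nat \<bar>n\<bar>) p * (norm (c n))\<^sup>2)"
    unfolding Re_coupling_circle_kernel[OF p] by (simp add: sum_distrib_left mult_ac)
  finally show "Qp p \<eta> = 4 * pi * (\<Sum>n | c n \<noteq> 0. Mn (nat \<bar>n\<bar>) p * (norm (c n))\<^sup>2)" .
qed

text \<open>The modes \<open>|n| \<le> 1\<close> drop out because their multipliers vanish. The factor \<open>4\<pi>\<close> is discarded in the
  lower bound and kept in the upper one, so that the same pair of constants bounds the multipliers and
  the form.\<close>

lemma Qp_bounds:
  assumes p: "1 < p" "p < 3" and \<eta>: "trig_poly \<eta> c"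
  defines "E \<equiv> \<Sum>n | c n \<noteq> 0 \<and> 2 \<le> \<bar>n\<bar>. real_of_int \<bar>n\<bar> powr (3 - p) * (norm (c n))\<^sup>2"
  shows "Mn_lower_const p * E \<le> Qp p \<eta>" and "Qp p \<eta> \<le> 4 * pi * Mn_upper_const p * E"
proof -
  let ?S = "{n. c n \<noteq> 0 \<and> 2 \<le> \<bar>n\<bar>}"
  have S: "finite {n. c n \<noteq> 0}" using \<eta> by (simp add: trig_poly_def)
  have z: "Mn (nat \<bar>n\<bar>) p = 0" if "\<bar>n\<bar> < 2" for n :: int
  proof -
    have "nat \<bar>n\<bar> = 0 \<or> nat \<bar>n\<bar> = 1" using that by linarith
    then show ?thesis using p Mn_0[of p] Mn_1[of p] by auto
  qed
  have z': "2 \<le> \<bar>n\<bar>" if "Mn (nat \<bar>n\<bar>) p \<noteq> 0" for n :: int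
    using z[of n] that by linarith
  have Q: "Qp p \<eta> = 4 * pi * (\<Sum>n\<in>?S. Mn (nat \<bar>n\<bar>) p * (norm (c n))\<^sup>2)"
    unfolding Qp_trig_poly(2)[OF p(1) \<eta>]
    using S z' by (intro arg_cong[where f = "(*) (4 * pi)"] sum.mono_neutral_right) auto
  have lo: "Mn_lower_const p * E \<le> (\<Sum>n\<in>?S. Mn (nat \<bar>n\<bar>) p * (norm (c n))\<^sup>2)"
    unfolding E_def sum_distrib_left
  proof (rule sum_mono)
    fix n :: int assume "n \<in> ?S"
    then have n: "2 \<le> nat \<bar>n\<bar>" by simp linarith
    show "Mn_lower_const p * (real_of_int \<bar>n\<bar> powr (3 - p) * (norm (c n))\<^sup>2) \<le> Mn (nat \<bar>n\<bar>) p * (norm (c n))\<^sup>2"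
      using mult_right_mono[OF Mn_bounds(1)[OF p n], of "(norm (c n))\<^sup>2"]
      by (simp add: mult.assoc)
  qed
  have hi: "(\<Sum>n\<in>?S. Mn (nat \<bar>n\<bar>) p * (norm (c n))\<^sup>2) \<le> Mn_upper_const p * E"
    unfolding E_def sum_distrib_left
  proof (rule sum_mono)
    fix n :: int assume "n \<in> ?S"
    then have n: "2 \<le> nat \<bar>n\<bar>" by simp linarith
    show "Mn (nat \<bar>n\<bar>) p * (norm (c n))\<^sup>2 \<le> Mn_upper_const p * (real_of_int \<bar>n\<bar> powr (3 - p) * (norm (c n))\<^sup>2)"
      using mult_right_mono[OF Mn_bounds(2)[OF p n], of "(norm (c n))\<^sup>2"]
      by (simp add: mult.assoc)
  qed
  have E: "0 \<le> Mn_lower_const p * E"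
    using Mn_const_pos_le[OF p] by (auto simp: E_def intro!: mult_nonneg_nonneg sum_nonneg)
  have "Mn_lower_const p * E \<le> 4 * pi * (Mn_lower_const p * E)"
    using mult_right_mono[OF _ E, of 1 "4 * pi"] pi_gt3 by simp
  also have "\<dots> \<le> Qp p \<eta>" unfolding Q using lo by (intro mult_left_mono) auto
  finally show "Mn_lower_const p * E \<le> Qp p \<eta>" .
  show "Qp p \<eta> \<le> 4 * pi * Mn_upper_const p * E"
    unfolding Q using mult_left_mono[OF hi, of "4 * pi"] by (simp add: mult.assoc)
qed

section \<open>Fourier coefficients and the Sobolev norm\<close>

lemma fourier_coeff_trig_poly:
  assumes \<eta>: "trig_poly \<eta> c"
  shows "fourier_coeff \<eta> n = c n"
proof -
  have S: "finite {n. c n \<noteq> 0}" using \<eta> by (simp add: trig_poly_def)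
  have integrand: "complex_of_real (\<eta> (exp (\<i> * of_real \<theta>))) * exp (- \<i> * of_int n * of_real \<theta>) =
      (\<Sum>m | c m \<noteq> 0. c m * cis (of_int (m - n) * \<theta>))" for \<theta>
  proof -
    have "exp (- \<i> * of_int n * of_real \<theta>) = cis (- of_int n * \<theta>)"
      using exp_i_int_eq_cis[of "- n" \<theta>] by simp
    then show ?thesis
      unfolding exp_i_eq_cis trig_poly_cis[OF \<eta>]
      by (simp add: sum_distrib_right mult.assoc cis_mult left_diff_distrib)
  qed
  have "has_bochner_integral angle_measure (\<lambda>\<theta>. \<Sum>m | c m \<noteq> 0. c m * cis (of_int (m - n) * \<theta>))
     (\<Sum>m | c m \<noteq> 0. c m * (if m - n = 0 then of_real (2 * pi) else 0))"
    by (intro has_bochner_integral_sum has_bochner_integral_mult_right has_bochner_integral_character)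
  also have "(\<Sum>m | c m \<noteq> 0. c m * (if m - n = 0 then of_real (2 * pi) else 0)) =
     (\<Sum>m | c m \<noteq> 0. if m = n then c n * of_real (2 * pi) else 0)"
    by (intro sum.cong) auto
  also have "\<dots> = c n * of_real (2 * pi)"
    using S by (simp add: sum.delta)
  finally have "(LBINT \<theta>:{0..2 * pi}. \<Sum>m | c m \<noteq> 0. c m * cis (of_int (m - n) * \<theta>)) = c n * of_real (2 * pi)"
    by (subst integral_angle_eq[symmetric])
      (auto simp: has_bochner_integral_iff intro!: borel_measurable_continuous_onI continuous_intros)
  then show ?thesis unfolding fourier_coeff_def integrand by simp
qed

lemma fourier_coeff_uminus: "fourier_coeff \<eta> (- n) = cnj (fourier_coeff \<eta> n)"
proof -
  have "cnj (LBINT \<theta>:{0..2 * pi}. complex_of_real (\<eta> (exp (\<i> * of_real \<theta>))) * exp (- \<i> * of_int n * of_real \<theta>))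
    = (LBINT \<theta>:{0..2 * pi}. cnj (complex_of_real (\<eta> (exp (\<i> * of_real \<theta>))) * exp (- \<i> * of_int n * of_real \<theta>)))"
    unfolding set_lebesgue_integral_def
    by (subst Bochner_Integration.integral_cnj[symmetric]) (simp add: scaleR_conv_of_real)
  then show ?thesis by (simp add: fourier_coeff_def exp_cnj)
qed

text \<open>The two orthogonality conditions say that \<open>c\<^sub>0 = 0\<close> and \<open>c\<^sub>-\<^sub>1 = 0\<close>, and \<open>c\<^sub>1 = 0\<close> follows because \<open>\<eta>\<close> is
  real. So the Sobolev norm sees only the frequencies \<open>|n| \<ge> 2\<close>, on which the form is coercive.\<close>

lemma Hdot_norm_sq_trig_poly:
  assumes \<eta>: "trig_poly \<eta> c"
    and mean: "(LBINT \<theta>:{0..2 * pi}. \<eta> (exp (\<i> * of_real \<theta>))) = 0"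
    and first: "(LBINT \<theta>:{0..2 * pi}. complex_of_real (\<eta> (exp (\<i> * of_real \<theta>))) * exp (\<i> * of_real \<theta>)) = 0"
  shows "Hdot_norm_sq ((3 - p) / 2) \<eta> =
    (\<Sum>n | c n \<noteq> 0 \<and> 2 \<le> \<bar>n\<bar>. real_of_int \<bar>n\<bar> powr (3 - p) * (norm (c n))\<^sup>2)"
proof -
  have S: "finite {n. c n \<noteq> 0}" using \<eta> by (simp add: trig_poly_def)
  note fc = fourier_coeff_trig_poly[OF \<eta>]
  have "(LBINT \<theta>:{0..2 * pi}. complex_of_real (\<eta> (exp (\<i> * of_real \<theta>)))) = 0"
    using mean by (simp add: set_integral_complex_of_real)
  then have 0: "c 0 = 0"
    using fc[of 0] by (simp add: fourier_coeff_def)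
  have m1: "c (- 1) = 0"
    using fc[of "- 1"] first by (simp add: fourier_coeff_def)
  have 1: "c 1 = 0"
    using fourier_coeff_uminus[of \<eta> "- 1"] fc[of 1] fc[of "- 1"] m1 by simp
  have "c n = 0" if "\<bar>n\<bar> < 2" for n
  proof -
    have "n = 0 \<or> n = 1 \<or> n = - 1" using that by linarith
    then show ?thesis using 0 1 m1 by auto
  qed
  then have large: "2 \<le> \<bar>n\<bar>" if "c n \<noteq> 0" for n using that by force
  have "2 * ((3 - p) / 2) = 3 - p" by simp
  then have "Hdot_norm_sq ((3 - p) / 2) \<eta> =
     (\<Sum>\<^sub>\<infinity>n\<in>{n::int. n \<noteq> 0}. real_of_int \<bar>n\<bar> powr (3 - p) * (norm (c n))\<^sup>2)"
    unfolding Hdot_norm_sq_def fc by (simp only:)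
  also have "\<dots> = (\<Sum>\<^sub>\<infinity>n | c n \<noteq> 0 \<and> 2 \<le> \<bar>n\<bar>. real_of_int \<bar>n\<bar> powr (3 - p) * (norm (c n))\<^sup>2)"
    by (rule infsum_cong_neutral) (use large in auto)
  also have "\<dots> = (\<Sum>n | c n \<noteq> 0 \<and> 2 \<le> \<bar>n\<bar>. real_of_int \<bar>n\<bar> powr (3 - p) * (norm (c n))\<^sup>2)"
    using S by (intro infsum_finite) auto
  finally show ?thesis .
qed

theorem theorem5p1:
  shows
  "(\<forall>s p :: real. 1/8 < s \<and> s < 1 \<and> p = 1 / s \<longrightarrow>
      1 < p \<and> p < 8 \<and> (p < 3 \<longleftrightarrow> 1/3 < s) \<and>
      (\<forall>n. set_integrable lborel {0..pi} (Mn_integrand n p)) \<and>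
      (\<forall>\<eta> c. trig_poly \<eta> c \<longrightarrow>
         integrable (circle_measure \<Otimes>\<^sub>M circle_measure)
           (\<lambda>z. Qp_integrand p \<eta> (fst z) (snd z)) \<and>
         Qp p \<eta> = 4 * pi * (\<Sum>n | c n \<noteq> 0. Mn (nat \<bar>n\<bar>) p * (norm (c n))\<^sup>2)) \<and>
      Mn 0 p = 0 \<and> Mn 1 p = 0 \<and> (\<forall>n. 0 \<le> Mn n p))
   \<and>
   (\<exists>a b :: real \<Rightarrow> real.
      (\<forall>s p :: real. 1/8 < s \<and> s < 1 \<and> p = 1 / s \<and> p < 3 \<longrightarrow>
         0 < a p \<and> a p \<le> b p \<and>
         (\<forall>n\<ge>2. a p * real n powr (3 - p) \<le> Mn n p \<and> Mn n p \<le> b p * real n powr (3 - p)) \<and>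
         (\<forall>\<eta> c. trig_poly \<eta> c \<longrightarrow>
            a p * (\<Sum>n | c n \<noteq> 0 \<and> 2 \<le> \<bar>n\<bar>. real_of_int \<bar>n\<bar> powr (3 - p) * (norm (c n))\<^sup>2) \<le> Qp p \<eta> \<and>
            Qp p \<eta> \<le> b p * (\<Sum>n | c n \<noteq> 0 \<and> 2 \<le> \<bar>n\<bar>. real_of_int \<bar>n\<bar> powr (3 - p) * (norm (c n))\<^sup>2)) \<and>
         (\<forall>\<eta> c. trig_poly \<eta> c \<and>
            (LBINT \<theta>:{0..2 * pi}. \<eta> (exp (\<i> * of_real \<theta>))) = 0 \<and>
            (LBINT \<theta>:{0..2 * pi}. complex_of_real (\<eta> (exp (\<i> * of_real \<theta>))) * exp (\<i> * of_real \<theta>)) = 0 \<longrightarrow>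
            a p * Hdot_norm_sq ((3 - p) / 2) \<eta> \<le> Qp p \<eta> \<and>
            Qp p \<eta> \<le> b p * Hdot_norm_sq ((3 - p) / 2) \<eta>)) \<and>
      (\<forall>\<delta>>0. \<exists>\<alpha> \<beta>. 0 < \<alpha> \<and> \<alpha> \<le> \<beta> \<and>
         (\<forall>p. 1 + \<delta> \<le> p \<and> p \<le> 3 - \<delta> \<longrightarrow> \<alpha> \<le> a p \<and> b p \<le> \<beta>)))"
proof (intro conjI)
  show "\<forall>s p :: real. 1/8 < s \<and> s < 1 \<and> p = 1 / s \<longrightarrow>
      1 < p \<and> p < 8 \<and> (p < 3 \<longleftrightarrow> 1/3 < s) \<and>
      (\<forall>n. set_integrable lborel {0..pi} (Mn_integrand n p)) \<and>
      (\<forall>\<eta> c. trig_poly \<eta> c \<longrightarrow>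
         integrable (circle_measure \<Otimes>\<^sub>M circle_measure)
           (\<lambda>z. Qp_integrand p \<eta> (fst z) (snd z)) \<and>
         Qp p \<eta> = 4 * pi * (\<Sum>n | c n \<noteq> 0. Mn (nat \<bar>n\<bar>) p * (norm (c n))\<^sup>2)) \<and>
      Mn 0 p = 0 \<and> Mn 1 p = 0 \<and> (\<forall>n. 0 \<le> Mn n p)"
  proof (intro allI impI)
    fix s p :: real
    assume sp: "1/8 < s \<and> s < 1 \<and> p = 1 / s"
    then have p: "1 < p" "p < 8" "p < 3 \<longleftrightarrow> 1/3 < s" by (auto simp: field_simps)
    then show "1 < p \<and> p < 8 \<and> (p < 3 \<longleftrightarrow> 1/3 < s) \<and>
      (\<forall>n. set_integrable lborel {0..pi} (Mn_integrand n p)) \<and>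
      (\<forall>\<eta> c. trig_poly \<eta> c \<longrightarrow>
         integrable (circle_measure \<Otimes>\<^sub>M circle_measure)
           (\<lambda>z. Qp_integrand p \<eta> (fst z) (snd z)) \<and>
         Qp p \<eta> = 4 * pi * (\<Sum>n | c n \<noteq> 0. Mn (nat \<bar>n\<bar>) p * (norm (c n))\<^sup>2)) \<and>
      Mn 0 p = 0 \<and> Mn 1 p = 0 \<and> (\<forall>n. 0 \<le> Mn n p)"
      using Mn_integrand_integrable Qp_trig_poly Mn_0 Mn_1 Mn_nonneg by blast
  qed
next
  define a where "a = Mn_lower_const"
  define b where "b = (\<lambda>p. 4 * pi * Mn_upper_const p)"
  have ab: "0 < a p" "Mn_upper_const p \<le> b p" "a p \<le> b p" if p: "1 < p" "p < 3" for p
  proof -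
    show "0 < a p" using Mn_const_pos_le[OF p] by (simp add: a_def)
    have "1 * Mn_upper_const p \<le> 4 * pi * Mn_upper_const p"
      using Mn_const_pos_le[OF p] pi_gt3 by (intro mult_right_mono) auto
    then show "Mn_upper_const p \<le> b p" by (simp add: b_def)
    then show "a p \<le> b p" using Mn_const_pos_le[OF p] by (simp add: a_def)
  qed
  show "\<exists>a b :: real \<Rightarrow> real.
      (\<forall>s p :: real. 1/8 < s \<and> s < 1 \<and> p = 1 / s \<and> p < 3 \<longrightarrow>
         0 < a p \<and> a p \<le> b p \<and>
         (\<forall>n\<ge>2. a p * real n powr (3 - p) \<le> Mn n p \<and> Mn n p \<le> b p * real n powr (3 - p)) \<and>
         (\<forall>\<eta> c. trig_poly \<eta> c \<longrightarrow>
            a p * (\<Sum>n | c n \<noteq> 0 \<and> 2 \<le> \<bar>n\<bar>. real_of_int \<bar>n\<bar> powr (3 - p) * (norm (c n))\<^sup>2) \<le> Qp p \<eta> \<and>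
            Qp p \<eta> \<le> b p * (\<Sum>n | c n \<noteq> 0 \<and> 2 \<le> \<bar>n\<bar>. real_of_int \<bar>n\<bar> powr (3 - p) * (norm (c n))\<^sup>2)) \<and>
         (\<forall>\<eta> c. trig_poly \<eta> c \<and>
            (LBINT \<theta>:{0..2 * pi}. \<eta> (exp (\<i> * of_real \<theta>))) = 0 \<and>
            (LBINT \<theta>:{0..2 * pi}. complex_of_real (\<eta> (exp (\<i> * of_real \<theta>))) * exp (\<i> * of_real \<theta>)) = 0 \<longrightarrow>
            a p * Hdot_norm_sq ((3 - p) / 2) \<eta> \<le> Qp p \<eta> \<and>
            Qp p \<eta> \<le> b p * Hdot_norm_sq ((3 - p) / 2) \<eta>)) \<and>
      (\<forall>\<delta>>0. \<exists>\<alpha> \<beta>. 0 < \<alpha> \<and> \<alpha> \<le> \<beta> \<and>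
         (\<forall>p. 1 + \<delta> \<le> p \<and> p \<le> 3 - \<delta> \<longrightarrow> \<alpha> \<le> a p \<and> b p \<le> \<beta>))"
  proof (rule exI[of _ a], rule exI[of _ b], intro conjI allI impI)
    fix s p :: real
    assume "1/8 < s \<and> s < 1 \<and> p = 1 / s \<and> p < 3"
    then have p: "1 < p" "p < 3" by (auto simp: field_simps)
    show "0 < a p" "a p \<le> b p" using ab[OF p] by auto
    {
      fix n :: nat assume n: "2 \<le> n"
      show "a p * real n powr (3 - p) \<le> Mn n p"
        using Mn_bounds(1)[OF p n] by (simp add: a_def)
      have "Mn n p \<le> Mn_upper_const p * real n powr (3 - p)" by (rule Mn_bounds(2)[OF p n])
      also have "\<dots> \<le> b p * real n powr (3 - p)" using ab(2)[OF p] by (intro mult_right_mono) auto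
      finally show "Mn n p \<le> b p * real n powr (3 - p)" .
    next
      fix \<eta> c assume "trig_poly \<eta> c"
      from Qp_bounds[OF p this]
      show "a p * (\<Sum>n | c n \<noteq> 0 \<and> 2 \<le> \<bar>n\<bar>. real_of_int \<bar>n\<bar> powr (3 - p) * (norm (c n))\<^sup>2) \<le> Qp p \<eta>"
        "Qp p \<eta> \<le> b p * (\<Sum>n | c n \<noteq> 0 \<and> 2 \<le> \<bar>n\<bar>. real_of_int \<bar>n\<bar> powr (3 - p) * (norm (c n))\<^sup>2)"
        by (simp_all only: a_def b_def)
    next
      fix \<eta> c
      assume "trig_poly \<eta> c \<and>
            (LBINT \<theta>:{0..2 * pi}. \<eta> (exp (\<i> * of_real \<theta>))) = 0 \<and>
            (LBINT \<theta>:{0..2 * pi}. complex_of_real (\<eta> (exp (\<i> * of_real \<theta>))) * exp (\<i> * of_real \<theta>)) = 0"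
      then have \<eta>: "trig_poly \<eta> c"
        and H: "Hdot_norm_sq ((3 - p) / 2) \<eta> =
          (\<Sum>n | c n \<noteq> 0 \<and> 2 \<le> \<bar>n\<bar>. real_of_int \<bar>n\<bar> powr (3 - p) * (norm (c n))\<^sup>2)"
        using Hdot_norm_sq_trig_poly by blast+
      show "a p * Hdot_norm_sq ((3 - p) / 2) \<eta> \<le> Qp p \<eta>" "Qp p \<eta> \<le> b p * Hdot_norm_sq ((3 - p) / 2) \<eta>"
        using Qp_bounds[OF p \<eta>] by (simp_all only: H a_def b_def)
    }
  next
    fix \<delta> :: real assume \<delta>: "0 < \<delta>"
    \<comment> \<open>The maximum matters only for \<open>\<delta> > 1\<close>, when no \<open>p\<close> is left to force \<open>\<alpha> \<le> \<beta>\<close>.\<close>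
    define \<beta> where "\<beta> = max (2 / 15) (4 * pi * (48 * pi / \<delta>))"
    have "2 / 15 \<le> a p \<and> b p \<le> \<beta>" if "1 + \<delta> \<le> p \<and> p \<le> 3 - \<delta>" for p
      using Mn_const_uniform[OF \<delta>, of p] that mult_left_mono[of "Mn_upper_const p" "48 * pi / \<delta>" "4 * pi"]
      by (simp add: a_def b_def \<beta>_def)
    then show "\<exists>\<alpha> \<beta>. 0 < \<alpha> \<and> \<alpha> \<le> \<beta> \<and> (\<forall>p. 1 + \<delta> \<le> p \<and> p \<le> 3 - \<delta> \<longrightarrow> \<alpha> \<le> a p \<and> b p \<le> \<beta>)"
      by (intro exI[of _ "2 / 15"] exI[of _ \<beta>]) (auto simp: \<beta>_def)
  qed
qed

end
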